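(* Let $D$ be a Dedekind domain and $J$ an ideal of $D$ such that $R=D/J$ is a finite ring, and let $\Psi$ be a subgroup of the group $\mathrm{Aut}(R)$ of ring automorphisms of $R$. Then $$\mathrm{I}_{\Psi}(\mathcal{S}_R)\ \geq\ \mathrm{D}_{\Psi}(\mathrm{U}(R))+\sum_{P\in \mathrm{Spec}(R)} \frac{\mathrm{T}\!\left(\mathrm{Ind}(P);\ \frac{|\Psi|}{|\mathrm{St}(P)|}\right)}{\frac{|\Psi|}{|\mathrm{St}(P)|}}.$$
   Context: Sequences over a set $A$ are finite unordered lists of elements of $A$ with repetition allowed; a subsequence is a sub-multiset; its length counts multiplicity. An idempotent of $R$ is $e\in R$ with $e^2=e$. $\mathcal{S}_R$ is the multiplicative semigroup of $R$ and $\mathrm{U}(R)$ its group of units; each $\psi\in\Psi$ restricts to an automorphism of $\mathrm{U}(R)$. $\mathrm{I}_{\Psi}(\mathcal{S}_R)$ is the least $\ell\in\mathbb{N}\cup\{\infty\}$ such that every sequence over $R$ of length at least $\ell$ contains a nonempty subsequence $a_1,\dots,a_r$ for which there exist $\psi_1,\dots,\psi_r\in\Psi$ (not necessarily distinct) with $\prod_{i=1}^r\psi_i(a_i)$ an idempotent of $R$. $\mathrm{D}_{\Psi}(\mathrm{U}(R))$ is the least positive integer $\ell$ such that every sequence over $\mathrm{U}(R)$ of length at least $\ell$ contains a nonempty subsequence $a_1,\dots,a_r$ for which there exist $\psi_1,\dots,\psi_r\in\Psi$ with $\prod_{i=1}^r\psi_i(a_i)=1_R$. $\mathrm{Spec}(R)$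 is the set of prime ideals of $R$. For a prime ideal $P$, $\mathrm{Ind}(P)$ is the least integer $t>0$ such that $P^t=P^{t+1}$, and $\mathrm{St}(P)=\{\psi\in\Psi:\psi(P)=P\}$ is its stabilizer. For positive integers $m,h$, $\mathrm{T}(m;h)$ is the maximum of $\sum_{i=1}^h t_i$ over all nonnegative integers $t_1,\dots,t_h$ satisfying $\sum_{i=1}^d i\,t_i<d\,m$ for every $d=1,2,\dots,h$. *)

theory Defs
  imports "HOL-Algebra.Algebra" "HOL-Library.Multiset" "HOL-Library.Extended_Real"
begin

section \<open>Dedekind domains\<close>

text \<open>
  Noetherian, integrally closed domains in which every nonzero prime ideal is maximal; fields
  are included. Integral closedness concerns a fraction \<open>a/b\<close> satisfying a monic equation
  \<open>(a/b)^n + \<Sum>i<n. c\<^sub>i (a/b)^i = 0\<close> over the domain. As HOL-Algebra has no fraction fields for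
  rings given by carriers, this equation is written multiplied by \<open>b^n\<close>, and \<open>a/b\<close> lying in the
  domain as divisibility of \<open>a\<close> by \<open>b\<close>.
\<close>

locale dedekind_domain = noetherian_domain D for D (structure) +
  assumes integrally_closed:
    "\<lbrakk> a \<in> carrier D; b \<in> carrier D - {\<zero>}; c \<in> {..<n} \<rightarrow> carrier D;
       a [^] (n::nat) \<oplus> (\<Oplus>i\<in>{..<n}. c i \<otimes> a [^] i \<otimes> b [^] (n - i)) = \<zero> \<rbrakk>
     \<Longrightarrow> \<exists>d \<in> carrier D. a = d \<otimes> b"
  and nonzero_prime_maximal: "\<lbrakk> primeideal P D; P \<noteq> {\<zero>} \<rbrakk> \<Longrightarrow> maximalideal P D"


section \<open>Ring automorphisms\<close>

text \<open>
  As in \<^const>\<open>AutoGroup\<close>, automorphisms are extensional functions, so that each automorphism is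
  represented by exactly one function and cardinalities of sets of automorphisms are meaningful.
\<close>

definition ring_auto :: "('a, 'b) ring_scheme \<Rightarrow> ('a \<Rightarrow> 'a) set"
  where "ring_auto R = ring_iso R R \<inter> extensional (carrier R)"

definition RingAutGroup :: "('a, 'b) ring_scheme \<Rightarrow> ('a \<Rightarrow> 'a) monoid"
  where "RingAutGroup R = BijGroup (carrier R) \<lparr>carrier := ring_auto R\<rparr>"

lemma (in ring) subgroup_ring_auto: "subgroup (ring_auto R) (BijGroup (carrier R))"
proof (rule group.subgroupI)
  show "group (BijGroup (carrier R))"
    by (rule group_BijGroup)
  show "ring_auto R \<subseteq> carrier (BijGroup (carrier R))"
    by (auto simp: ring_auto_def ring_iso_def BijGroup_def Bij_def)
  have "restrict id (carrier R) \<in> ring_auto R"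
    by (auto simp: ring_auto_def ring_iso_def ring_hom_def bij_betw_def inj_on_def)
  then show "ring_auto R \<noteq> {}"
    by blast
next
  fix f assume f: "f \<in> ring_auto R"
  then have B: "f \<in> Bij (carrier R)"
    by (auto simp: ring_auto_def ring_iso_def Bij_def)
  have "inv_into (carrier R) f \<in> ring_iso R R"
    using f ring_iso_set_sym[OF ring_axioms] by (auto simp: ring_auto_def)
  then have "restrict (inv_into (carrier R) f) (carrier R) \<in> ring_auto R"
    by (auto simp: ring_auto_def ring_iso_def ring_hom_def bij_betw_def inj_on_def)
  then show "inv\<^bsub>BijGroup (carrier R)\<^esub> f \<in> ring_auto R"
    by (simp add: inv_BijGroup[OF B])
next
  fix f g assume fg: "f \<in> ring_auto R" "g \<in> ring_auto R"
  then have B: "f \<in> Bij (carrier R)" "g \<in> Bij (carrier R)"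
    by (auto simp: ring_auto_def ring_iso_def Bij_def)
  have "f \<circ> g \<in> ring_iso R R"
    using fg by (auto simp: ring_auto_def intro: ring_iso_set_trans)
  then have "compose (carrier R) f g \<in> ring_auto R"
    by (auto simp: ring_auto_def ring_iso_def ring_hom_def compose_def bij_betw_def inj_on_def)
  then show "f \<otimes>\<^bsub>BijGroup (carrier R)\<^esub> g \<in> ring_auto R"
    using B by (simp add: BijGroup_def)
qed

lemma (in ring) group_RingAutGroup: "group (RingAutGroup R)"
  unfolding RingAutGroup_def
  by (rule subgroup.subgroup_is_group[OF subgroup_ring_auto group_BijGroup])


section \<open>Weighted zero-sum type invariants\<close>

text \<open>
  Sequences (finite, unordered, with repetition) are multisets. The predicate says that \<open>T\<close> has a
  nonempty subsequence \<open>a\<^sub>1, \<dots>, a\<^sub>r\<close> such that \<open>\<psi>\<^sub>1(a\<^sub>1) \<cdots> \<psi>\<^sub>r(a\<^sub>r) \<in> E\<close> for some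
  \<open>\<psi>\<^sub>1, \<dots>, \<psi>\<^sub>r \<in> \<Psi>\<close>; the subsequence is listed in some order.
\<close>

definition has_weighted_product ::
  "('a, 'b) monoid_scheme \<Rightarrow> ('a \<Rightarrow> 'a) set \<Rightarrow> 'a multiset \<Rightarrow> 'a set \<Rightarrow> bool"
  where "has_weighted_product G \<Psi> T E \<longleftrightarrow>
    (\<exists>as \<psi>. as \<noteq> [] \<and> mset as \<subseteq># T \<and> (\<forall>i<length as. \<psi> i \<in> \<Psi>) \<and>
       (\<Otimes>\<^bsub>G\<^esub>i\<in>{..<length as}. \<psi> i (as ! i)) \<in> E)"

definition idempotents :: "('a, 'b) monoid_scheme \<Rightarrow> 'a set"
  where "idempotents G = {e \<in> carrier G. e \<otimes>\<^bsub>G\<^esub> e = e}"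

text \<open>The infimum is \<open>\<infinity>\<close> if no \<open>l\<close> qualifies. A ring is used here as its multiplicative monoid.\<close>

definition erdos_burgess :: "('a \<Rightarrow> 'a) set \<Rightarrow> ('a, 'b) monoid_scheme \<Rightarrow> enat"
  where "erdos_burgess \<Psi> G = Inf {enat l |l.
    \<forall>T. set_mset T \<subseteq> carrier G \<and> l \<le> size T \<longrightarrow> has_weighted_product G \<Psi> T (idempotents G)}"

text \<open>For finite \<open>G\<close> and nonempty \<open>\<Psi>\<close> the least number exists.\<close>

definition davenport :: "('a \<Rightarrow> 'a) set \<Rightarrow> ('a, 'b) monoid_scheme \<Rightarrow> nat"
  where "davenport \<Psi> G = (LEAST l. 0 < l \<and>
    (\<forall>T. set_mset T \<subseteq> carrier G \<and> l \<le> size T \<longrightarrow> has_weighted_product G \<Psi> T {\<one>\<^bsub>G\<^esub>}))"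


section \<open>Prime ideals\<close>

definition Spec :: "('a, 'b) ring_scheme \<Rightarrow> 'a set set"
  where "Spec R = {P. primeideal P R}"

definition ideal_index :: "('a, 'b) ring_scheme \<Rightarrow> 'a set \<Rightarrow> nat"
  where "ideal_index R P =
    (LEAST t. 0 < t \<and> P [^]\<^bsub>ideals_set R\<^esub> t = P [^]\<^bsub>ideals_set R\<^esub> (t + 1))"

definition ideal_stabilizer :: "('a \<Rightarrow> 'a) set \<Rightarrow> 'a set \<Rightarrow> ('a \<Rightarrow> 'a) set"
  where "ideal_stabilizer \<Psi> P = {\<psi> \<in> \<Psi>. \<psi> ` P = P}"

definition T_max :: "nat \<Rightarrow> nat \<Rightarrow> nat"
  where "T_max m h =
    Max {\<Sum>i=1..h. t i |t :: nat \<Rightarrow> nat. \<forall>d\<in>{1..h}. (\<Sum>i=1..d. i * t i) < d * m}"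

text \<open>The division is exact, the stabilizer being a subgroup.\<close>

definition stabilizer_index :: "('a \<Rightarrow> 'a) set \<Rightarrow> 'a set \<Rightarrow> nat"
  where "stabilizer_index \<Psi> P = card \<Psi> div card (ideal_stabilizer \<Psi> P)"

end

theory Submission
  imports Defs
begin

text \<open>
  A prime \<open>\<pp>\<close> of a Dedekind domain is locally principal: \<open>u \<pp> \<subseteq> (p)\<close> for some
  \<open>p \<in> \<pp>\<close>, \<open>u \<notin> \<pp>\<close>, and this passes to the finite quotient \<open>R\<close>. It makes the order at a prime \<open>P\<close>
  of \<open>R\<close> additive below \<open>Ind(P)\<close>: a product of units at \<open>P\<close> and of \<open>k < Ind(P)\<close> elements of
  \<open>P - P\<^sup>2\<close> lies outside \<open>P\<^bsup>k+1\<^esup>\<close>. An idempotent in \<open>P\<close> lies in all powers of \<open>P\<close>, so no such product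
  with \<open>k > 0\<close> is idempotent.

  On a \<open>\<Psi>\<close>-orbit of size \<open>h\<close> the index \<open>m = Ind(P)\<close> is constant, so its summands add up to
  \<open>T(m; h)\<close>. Let \<open>t\<close> attain this maximum and take
  \<open>t\<^sub>i\<close> copies of an element of order 1 at exactly \<open>i\<close> primes of the orbit and of order 0 at all other
  primes; do this for every orbit and add an extremal sequence of units for the Davenport constant.
  If a weighted product of a subsequence uses a nonunit, let \<open>d\<close> be the largest index used in that
  orbit. The orders of the factors at the primes of the orbit sum to at most
  \<open>\<Sum>i\<le>d. i t\<^sub>i < d m\<close>, so one of the \<open>d\<close> primes containing a factor of index \<open>d\<close> gets
  total order between 1 and \<open>m - 1\<close>.
\<close>


section \<open>Local principality of primes in Dedekind domains\<close>

text \<open>In a noetherian ring the union of a nonempty chain of ideals is a member of the chain,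
  so Zorn's lemma applies to every nonempty set of ideals.\<close>

lemma (in noetherian_ring) exists_maximal_ideal_in:
  assumes "S \<noteq> {}" and "\<And>I. I \<in> S \<Longrightarrow> ideal I R"
  obtains M where "M \<in> S" and "\<And>I. \<lbrakk> I \<in> S; M \<subseteq> I \<rbrakk> \<Longrightarrow> I = M"
proof -
  have "\<exists>M\<in>S. \<forall>I\<in>S. M \<subseteq> I \<longrightarrow> I = M"
  proof (rule subset_Zorn)
    fix C assume C: "subset.chain S C"
    show "\<exists>U\<in>S. \<forall>V\<in>C. V \<subseteq> U"
    proof (cases "C = {}")
      case True
      then show ?thesis using assms(1) by auto
    next
      case False
      have "C \<subseteq> S" using C by (auto simp: subset.chain_def)
      then have "subset.chain {I. ideal I R} C"
        using C assms(2) by (auto simp: subset.chain_def)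
      then have "\<Union>C \<in> C"
        using ideal_chain_is_trivial[OF False] by blast
      then show ?thesis using \<open>C \<subseteq> S\<close> by blast
    qed
  qed
  then show thesis using that by blast
qed

text \<open>No determinants are needed: the elements \<open>c\<^sub>n = a (b/a)\<^sup>n\<close> all lie in \<open>P\<close>, and the chain of ideals
  \<open>(c\<^sub>0, \<dots>, c\<^sub>n)\<close> becomes stationary, which gives a monic equation for \<open>b/a\<close>.\<close>

lemma (in dedekind_domain) fraction_stabilizing_ideal_integral:
  assumes P: "ideal P D" and a: "a \<in> P" "a \<noteq> \<zero>" and b: "b \<in> carrier D"
    and stable: "\<And>q. q \<in> P \<Longrightarrow> \<exists>v\<in>P. b \<otimes> q = a \<otimes> v"
  shows "\<exists>d\<in>carrier D. b = d \<otimes> a"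
proof -
  \<comment> \<open>\<open>f\<close> stands for multiplication by \<open>b/a\<close>, which by
    \<open>stable\<close> maps \<open>P\<close> into itself.\<close>
  obtain f where f: "\<And>q. q \<in> P \<Longrightarrow> f q \<in> P" "\<And>q. q \<in> P \<Longrightarrow> b \<otimes> q = a \<otimes> f q"
    using stable by metis
  define c where "c n = (f ^^ n) a" for n
  have ac: "a \<in> carrier D" using a P by (simp add: ideal.Icarr)
  have cP: "c n \<in> P" for n
    unfolding c_def using a f by (induction n) auto
  then have cc: "c n \<in> carrier D" for n using P by (simp add: ideal.Icarr)
  have c_Suc: "a \<otimes> c (Suc n) = b \<otimes> c n" for n
    using f(2)[OF cP[of n]] by (simp add: c_def)
  have c_pow: "a [^] n \<otimes> c n = a \<otimes> b [^] n" for n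
  proof (induction n)
    case 0 then show ?case using ac by (simp add: c_def)
  next
    case (Suc n)
    have "a [^] Suc n \<otimes> c (Suc n) = a [^] n \<otimes> (a \<otimes> c (Suc n))"
      using ac cc by (simp add: m_assoc)
    also have "\<dots> = b \<otimes> (a [^] n \<otimes> c n)"
      unfolding c_Suc using ac b cc by (simp add: m_ac)
    also have "\<dots> = a \<otimes> b [^] Suc n"
      unfolding Suc using ac b by (simp add: m_ac)
    finally show ?case .
  qed
  \<comment> \<open>\<open>I n\<close> is generated by \<open>c 0, ..., c (n - 1)\<close>, starting
    from the zero ideal.\<close>
  define I where "I = rec_nat {\<zero>} (\<lambda>n K. K <+> PIdl (c n))"
  have I_Suc: "I (Suc n) = I n <+> PIdl (c n)" for n by (simp add: I_def)
  have I: "ideal (I n) D" for n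
  proof (induction n)
    case 0 then show ?case by (simp add: I_def zeroideal)
  next
    case (Suc n) then show ?case
      unfolding I_Suc using add_ideals cgenideal_ideal cc by blast
  qed
  have I_mono_Suc: "I n \<subseteq> I (Suc n)" for n
  proof
    fix x assume x: "x \<in> I n"
    then have "x \<in> carrier D" using I ideal.Icarr by metis
    moreover have "\<zero> \<in> PIdl (c n)"
      using cgenideal_ideal[OF cc] additive_subgroup.zero_closed ideal.axioms(1) by metis
    ultimately have "x = x \<oplus> \<zero>" "\<zero> \<in> PIdl (c n)" by simp_all
    then show "x \<in> I (Suc n)"
      unfolding I_Suc set_add_def' using x by blast
  qed
  then have I_mono: "m \<le> n \<Longrightarrow> I m \<subseteq> I n" for m n
    by (rule lift_Suc_mono_le)
  have c_in: "c n \<in> I (Suc n)" for n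
  proof -
    have "\<zero> \<in> I n" using I additive_subgroup.zero_closed ideal.axioms(1) by metis
    moreover have "c n = \<zero> \<oplus> c n" using cc by simp
    ultimately show ?thesis
      unfolding I_Suc set_add_def' using cgenideal_self[OF cc[of n]] by blast
  qed
  \<comment> \<open>For \<open>i < n\<close>, \<open>c_pow\<close> turns \<open>a^n c_i\<close> into
    \<open>a b^i a^(n-i)\<close>, so a combination of the generators with coefficients
    \<open>r i\<close> becomes the right-hand side. The common factor \<open>a\<close> stays in
    front to be cancelled later.\<close>
  have expand: "\<exists>r\<in>{..<n} \<rightarrow> carrier D.
      a [^] n \<otimes> x = a \<otimes> (\<Oplus>i\<in>{..<n}. r i \<otimes> b [^] i \<otimes> a [^] (n - i))" if "x \<in> I n" for n x
    using that
  proof (induction n arbitrary: x)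
    case 0 then show ?case using ac by (simp add: I_def)
  next
    case (Suc n)
    then obtain y s where y: "y \<in> I n" and s: "s \<in> carrier D" and x: "x = y \<oplus> s \<otimes> c n"
      unfolding I_Suc set_add_def' cgenideal_def by auto
    obtain r where r: "r \<in> {..<n} \<rightarrow> carrier D"
      and yr: "a [^] n \<otimes> y = a \<otimes> (\<Oplus>i\<in>{..<n}. r i \<otimes> b [^] i \<otimes> a [^] (n - i))"
      using Suc.IH[OF y] by blast
    have yc: "y \<in> carrier D" using y I ideal.Icarr by metis
    define r' where "r' = r(n := s)"
    have r': "r' \<in> {..<Suc n} \<rightarrow> carrier D" using r s by (auto simp: r'_def less_Suc_eq)
    let ?S = "\<Oplus>i\<in>{..<n}. r i \<otimes> b [^] i \<otimes> a [^] (n - i)"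
    have Sc: "?S \<in> carrier D" using r ac b by (intro finsum_closed) auto
    have "(\<Oplus>i\<in>{..<n}. r' i \<otimes> b [^] i \<otimes> a [^] (Suc n - i))
        = (\<Oplus>i\<in>{..<n}. r i \<otimes> b [^] i \<otimes> a [^] (n - i) \<otimes> a)"
    proof (rule finsum_cong')
      show "(\<lambda>i. r i \<otimes> b [^] i \<otimes> a [^] (n - i) \<otimes> a) \<in> {..<n} \<rightarrow> carrier D"
        using r ac b by auto
      fix i assume i: "i \<in> {..<n}"
      then have "r i \<in> carrier D" using r by auto
      then show "r' i \<otimes> b [^] i \<otimes> a [^] (Suc n - i) = r i \<otimes> b [^] i \<otimes> a [^] (n - i) \<otimes> a"
        using i ac b by (simp add: r'_def Suc_diff_le m_assoc)
    qed simp
    also have "\<dots> = ?S \<otimes> a"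
      using r ac b by (intro finsum_ldistr[symmetric]) auto
    finally have S': "(\<Oplus>i\<in>{..<Suc n}. r' i \<otimes> b [^] i \<otimes> a [^] (Suc n - i))
        = s \<otimes> b [^] n \<otimes> a \<oplus> ?S \<otimes> a"
      using r r' ac b s
      by (simp add: lessThan_Suc finsum_insert Pi_def r'_def)
    have "a [^] Suc n \<otimes> x = a \<otimes> (a [^] n \<otimes> y) \<oplus> s \<otimes> a \<otimes> (a [^] n \<otimes> c n)"
      unfolding x using ac s yc cc by (simp add: m_ac r_distr)
    also have "\<dots> = a \<otimes> (s \<otimes> b [^] n \<otimes> a \<oplus> ?S \<otimes> a)"
      unfolding yr c_pow using ac s b Sc by (simp add: m_ac r_distr a_comm)
    finally show ?case unfolding S'[symmetric] using r' by (rule bexI)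
  qed
  have "subset.chain {I. ideal I D} (range I)"
    unfolding subset_chain_def
  proof (intro conjI ballI)
    show "range I \<subseteq> {I. ideal I D}" using I by auto
    fix K L assume "K \<in> range I" "L \<in> range I"
    then show "K \<subseteq> L \<or> L \<subseteq> K" using I_mono nat_le_linear by (metis imageE)
  qed
  then obtain N where N: "\<Union>(range I) = I N"
    using ideal_chain_is_trivial[of "range I"] by auto
  \<comment> \<open>Now \<open>c N\<close> is a combination of earlier \<open>c i\<close>;
    \<open>expand\<close> and \<open>c_pow\<close> express \<open>b^N\<close> through lower powers
    of \<open>b\<close>.\<close>
  then have "c N \<in> I N" using c_in[of N] by blast
  then obtain r where r: "r \<in> {..<N} \<rightarrow> carrier D"
    and e: "a [^] N \<otimes> c N = a \<otimes> (\<Oplus>i\<in>{..<N}. r i \<otimes> b [^] i \<otimes> a [^] (N - i))"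
    using expand by blast
  let ?S = "\<Oplus>i\<in>{..<N}. r i \<otimes> b [^] i \<otimes> a [^] (N - i)"
  have Sc: "?S \<in> carrier D" using r ac b by (intro finsum_closed) auto
  have "b [^] N = ?S"
    using e unfolding c_pow using m_lcancel[OF a(2) ac] Sc b by simp
  \<comment> \<open>The equation in \<open>integrally_closed\<close> adds the lower terms, so the
    coefficients change sign.\<close>
  moreover have "(\<Oplus>i\<in>{..<N}. (\<ominus> r i) \<otimes> b [^] i \<otimes> a [^] (N - i)) = \<ominus> ?S"
  proof -
    have "(\<Oplus>i\<in>{..<N}. (\<ominus> r i) \<otimes> b [^] i \<otimes> a [^] (N - i))
        = (\<Oplus>i\<in>{..<N}. \<ominus> \<one> \<otimes> (r i \<otimes> b [^] i \<otimes> a [^] (N - i)))"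
      using r ac b by (intro finsum_cong') (auto simp: l_minus Pi_def)
    also have "\<dots> = \<ominus> \<one> \<otimes> ?S"
      using r ac b by (intro finsum_rdistr[symmetric]) auto
    finally show ?thesis using Sc by (simp add: l_minus)
  qed
  ultimately have "b [^] N \<oplus> (\<Oplus>i\<in>{..<N}. (\<ominus> r i) \<otimes> b [^] i \<otimes> a [^] (N - i)) = \<zero>"
    using Sc by (simp add: r_neg)
  then show ?thesis
    using integrally_closed[of b a "\<lambda>i. \<ominus> r i" N] r b ac a(2) by auto
qed

text \<open>For \<open>0 \<noteq> a \<in> P\<close>, a maximal one among the ideals \<open>(a) : b\<close> contained in \<open>P\<close> is a nonzero prime, hence
  equals \<open>P\<close>. Then \<open>(b/a) P\<close> lies in the domain, but not in \<open>P\<close> because \<open>b/a\<close> is not integral.\<close>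

lemma (in dedekind_domain) prime_ideal_locally_principal:
  assumes P: "primeideal P D"
  shows "\<exists>p\<in>P. \<exists>u\<in>carrier D - P. \<forall>q\<in>P. \<exists>w\<in>carrier D. u \<otimes> q = p \<otimes> w"
proof (cases "P = {\<zero>}")
  case True
  have "\<one> \<notin> P" using P primeideal.I_notcarr ideal.one_imp_carrier primeideal.axioms(1) by blast
  then show ?thesis using True by (auto intro!: bexI[of _ \<one>] bexI[of _ \<zero>])
next
  case False
  interpret P: primeideal P D by fact
  obtain a where a: "a \<in> P" "a \<noteq> \<zero>" using False P.zero_closed by blast
  then have ac: "a \<in> carrier D" by (simp add: P.Icarr)
  \<comment> \<open>This is the ideal \<open>(a) : b\<close>, the set of denominators of
    \<open>b/a\<close>.\<close>
  define colon where "colon b = {x \<in> carrier D. \<exists>v\<in>carrier D. b \<otimes> x = a \<otimes> v}" for b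
  have colon: "ideal (colon b) D" if b: "b \<in> carrier D" for b
  proof (rule idealI)
    show "ring D" by (rule ring_axioms)
    show "subgroup (colon b) (add_monoid D)"
    proof (rule add.subgroupI)
      show "colon b \<subseteq> carrier D" by (auto simp: colon_def)
      show "colon b \<noteq> {}" using b ac by (auto simp: colon_def intro!: exI[of _ \<zero>] bexI[of _ \<zero>])
      fix x assume "x \<in> colon b"
      then obtain v where v: "x \<in> carrier D" "v \<in> carrier D" "b \<otimes> x = a \<otimes> v"
        by (auto simp: colon_def)
      then have "b \<otimes> (\<ominus> x) = a \<otimes> (\<ominus> v)" using b ac by (simp add: r_minus)
      then show "\<ominus> x \<in> colon b" using v by (auto simp: colon_def)
      fix y assume "y \<in> colon b"
      then obtain w where w: "y \<in> carrier D" "w \<in> carrier D" "b \<otimes> y = a \<otimes> w"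
        by (auto simp: colon_def)
      then have "b \<otimes> (x \<oplus> y) = a \<otimes> (v \<oplus> w)" using b ac v by (simp add: r_distr)
      then show "x \<oplus> y \<in> colon b" using v w by (auto simp: colon_def)
    qed
    fix x s assume "x \<in> colon b" and s: "s \<in> carrier D"
    then obtain v where v: "x \<in> carrier D" "v \<in> carrier D" "b \<otimes> x = a \<otimes> v"
      by (auto simp: colon_def)
    have "b \<otimes> (x \<otimes> s) = a \<otimes> (v \<otimes> s)" using v s b ac by (metis m_assoc)
    then show "x \<otimes> s \<in> colon b" using v s by (auto simp: colon_def)
    then show "s \<otimes> x \<in> colon b" using v s by (simp add: m_comm)
  qed
  define S where "S = {colon b |b. b \<in> carrier D \<and> colon b \<subseteq> P}"
  \<comment> \<open>\<open>colon \<one>\<close> is the principal ideal \<open>(a)\<close>.\<close>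
  have "colon \<one> \<in> S"
    unfolding S_def using P.I_r_closed[OF a(1)] by (auto simp: colon_def intro!: exI[of _ \<one>])
  then have "S \<noteq> {}" by auto
  moreover have "\<And>I. I \<in> S \<Longrightarrow> ideal I D" using colon by (auto simp: S_def)
  ultimately obtain M where M: "M \<in> S" "\<And>I. \<lbrakk> I \<in> S; M \<subseteq> I \<rbrakk> \<Longrightarrow> I = M"
    using exists_maximal_ideal_in by blast
  obtain b where b: "b \<in> carrier D" "M = colon b" "colon b \<subseteq> P"
    using M(1) by (auto simp: S_def)
  have grow: "colon b \<subseteq> colon (s \<otimes> b)" if s: "s \<in> carrier D" for s
  proof
    fix x assume "x \<in> colon b"
    then obtain v where v: "x \<in> carrier D" "v \<in> carrier D" "b \<otimes> x = a \<otimes> v"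
      by (auto simp: colon_def)
    have "s \<otimes> b \<otimes> x = a \<otimes> (s \<otimes> v)"
      using v s b ac by (metis m_assoc m_lcomm)
    then show "x \<in> colon (s \<otimes> b)" using v s by (auto simp: colon_def)
  qed
  have swap: "x \<in> colon (s \<otimes> b) \<longleftrightarrow> s \<otimes> x \<in> colon b" if "s \<in> carrier D" "x \<in> carrier D" for x s
    using that b by (auto simp: colon_def m_ac)
  \<comment> \<open>Let \<open>x y\<close> lie in \<open>colon b\<close>. If
    \<open>colon (y b)\<close> stays inside \<open>P\<close>, maximality makes it equal to
    \<open>colon b\<close>, and it contains \<open>x\<close>. Otherwise it has an element
    \<open>s\<close> outside \<open>P\<close>; then \<open>colon (s b)\<close> stays inside
    \<open>P\<close> because \<open>P\<close> is prime, so it equals \<open>colon b\<close>, and it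
    contains \<open>y\<close>.\<close>
  have prime: "primeideal (colon b) D"
  proof (rule primeidealI)
    show "ideal (colon b) D" using b colon by blast
    show "cring D" by (rule is_cring)
    show "carrier D \<noteq> colon b" using b(3) P.I_notcarr P.a_subset by blast
    fix x y assume xy: "x \<in> carrier D" "y \<in> carrier D" "x \<otimes> y \<in> colon b"
    show "x \<in> colon b \<or> y \<in> colon b"
    proof (cases "colon (y \<otimes> b) \<subseteq> P")
      case True
      then have "colon (y \<otimes> b) = colon b"
        using M(2)[of "colon (y \<otimes> b)"] grow xy b by (auto simp: S_def)
      moreover have "x \<in> colon (y \<otimes> b)" using xy by (subst swap) (auto simp: m_comm)
      ultimately show ?thesis by blast
    next
      case False
      then obtain s where s: "s \<in> colon (y \<otimes> b)" "s \<notin> P" by blast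
      then have sc: "s \<in> carrier D" by (auto simp: colon_def)
      have "colon (s \<otimes> b) \<subseteq> P"
      proof
        fix z assume z: "z \<in> colon (s \<otimes> b)"
        then have zc: "z \<in> carrier D" by (auto simp: colon_def)
        then have "s \<otimes> z \<in> P" using z swap sc b(3) by blast
        then show "z \<in> P" using P.I_prime[OF sc zc] s(2) by blast
      qed
      then have "colon (s \<otimes> b) = colon b"
        using M(2)[of "colon (s \<otimes> b)"] grow sc b by (auto simp: S_def)
      moreover have "y \<in> colon (s \<otimes> b)"
        using s(1) sc xy swap by (metis m_comm)
      ultimately show ?thesis by blast
    qed
  qed
  have "a \<in> colon b" using ac b m_comm[of b a] by (auto simp: colon_def)
  then have "colon b \<noteq> {\<zero>}" using a by blast
  then have "maximalideal (colon b) D" using prime nonzero_prime_maximal by blast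
  then have PM: "P = colon b"
    using maximalideal.I_maximal[of "colon b" D P] b(3) P.is_ideal P.a_subset P.I_notcarr by auto
  \<comment> \<open>Otherwise multiplication by \<open>b/a\<close> preserves \<open>P\<close>, so
    \<open>b/a\<close> lies in the domain and \<open>colon b\<close> contains
    \<open>\<one>\<close>.\<close>
  have "\<exists>p\<in>P. \<exists>u\<in>carrier D - P. b \<otimes> p = a \<otimes> u"
  proof (rule ccontr)
    assume n: "\<not> ?thesis"
    have "\<exists>v\<in>P. b \<otimes> q = a \<otimes> v" if "q \<in> P" for q
    proof -
      have "q \<in> colon b" using that PM by blast
      then obtain v where "v \<in> carrier D" "b \<otimes> q = a \<otimes> v"
        unfolding colon_def by blast
      then show ?thesis using that n by blast
    qed
    then obtain d where "d \<in> carrier D" "b = d \<otimes> a"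
      using fraction_stabilizing_ideal_integral[OF P.is_ideal a b(1)] by blast
    then have "b \<otimes> \<one> = a \<otimes> d" using ac by (simp add: m_comm)
    then have "\<one> \<in> colon b" using \<open>d \<in> carrier D\<close> unfolding colon_def by blast
    then show False using PM P.one_imp_carrier P.I_notcarr by blast
  qed
  then obtain p u where pu: "p \<in> P" "u \<in> carrier D" "u \<notin> P" "b \<otimes> p = a \<otimes> u" by blast
  have pc: "p \<in> carrier D" using pu P.Icarr by blast
  \<comment> \<open>Here \<open>u\<close> is \<open>(b/a) p\<close> and \<open>w\<close> is
    \<open>(b/a) q\<close>, so both sides are \<open>(b/a) p q\<close>.\<close>
  have "\<exists>w\<in>carrier D. u \<otimes> q = p \<otimes> w" if q: "q \<in> P" for q
  proof -
    have qc: "q \<in> carrier D" using q P.Icarr by blast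
    obtain w where w: "w \<in> carrier D" "b \<otimes> q = a \<otimes> w"
      using q unfolding PM colon_def by blast
    have "a \<otimes> (u \<otimes> q) = (b \<otimes> p) \<otimes> q" using pu ac qc by (simp add: m_assoc)
    also have "\<dots> = p \<otimes> (b \<otimes> q)" using pc qc b by (simp add: m_ac)
    also have "\<dots> = a \<otimes> (p \<otimes> w)" using w pc ac by (simp add: m_lcomm)
    finally have "u \<otimes> q = p \<otimes> w"
      using m_lcancel[OF a(2) ac] pu(2) qc pc w(1) by simp
    then show ?thesis using w by blast
  qed
  then show ?thesis using pu by blast
qed

text \<open>The preimage of \<open>P\<close> in \<open>D\<close> is prime, and the residue classes
  of its \<open>p\<close> and \<open>u\<close> serve for \<open>P\<close>, every element of
  \<open>P\<close> being the class of an element of the preimage.\<close>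

lemma prime_ideal_quotient_locally_principal:
  assumes D: "dedekind_domain D" and J: "ideal J D" and P: "primeideal P (D Quot J)"
  shows "\<exists>p\<in>P. \<exists>u\<in>carrier (D Quot J) - P. \<forall>q\<in>P. \<exists>w\<in>carrier (D Quot J).
    u \<otimes>\<^bsub>D Quot J\<^esub> q = p \<otimes>\<^bsub>D Quot J\<^esub> w"
proof -
  let ?R = "D Quot J" and ?h = "(+>\<^bsub>D\<^esub>) J"
  interpret D: dedekind_domain D by fact
  note h_hom = ideal.rcos_ring_hom[OF J]
  have carr: "carrier ?R = ?h ` carrier D" 
    unfolding FactRing_def A_RCOSETS_def' by auto
  have PR: "P \<subseteq> carrier ?R" using ideal.Icarr[OF primeideal.axioms(1)[OF P]] by blast
  define P' where "P' = {r \<in> carrier D. ?h r \<in> P}"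
  have "primeideal P' D"
    unfolding P'_def by (rule ring_hom_ring.primeideal_vimage[OF ideal.rcos_ring_hom_ring[OF J] D.is_cring P])
  then obtain p u where p: "p \<in> P'" and u: "u \<in> carrier D - P'"
    and pu: "\<And>q. q \<in> P' \<Longrightarrow> \<exists>w\<in>carrier D. u \<otimes>\<^bsub>D\<^esub> q = p \<otimes>\<^bsub>D\<^esub> w"
    using D.prime_ideal_locally_principal by metis
  have "\<exists>w\<in>carrier ?R. ?h u \<otimes>\<^bsub>?R\<^esub> q = ?h p \<otimes>\<^bsub>?R\<^esub> w" if q: "q \<in> P" for q
  proof -
    obtain q' where q': "q' \<in> carrier D" "q = ?h q'" using q PR carr by blast
    then obtain w where w: "w \<in> carrier D" "u \<otimes>\<^bsub>D\<^esub> q' = p \<otimes>\<^bsub>D\<^esub> w"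
      using pu[of q'] q by (auto simp: P'_def)
    then have "?h u \<otimes>\<^bsub>?R\<^esub> q = ?h p \<otimes>\<^bsub>?R\<^esub> ?h w"
      using q' u p by (simp add: P'_def ring_hom_mult[OF h_hom, symmetric])
    then show ?thesis using ring_hom_closed[OF h_hom w(1)] by blast
  qed
  moreover have "?h p \<in> P" "?h u \<in> carrier ?R - P"
    using p u ring_hom_closed[OF h_hom] by (auto simp: P'_def)
  ultimately show ?thesis by blast
qed


section \<open>Orders at primes in finite rings\<close>

text \<open>This is the interface to the Dedekind domain: orders at the primes of \<open>R\<close>
  are developed from these two properties.\<close>

locale finite_locally_principal_ring = cring R for R (structure) +
  assumes finite_carrier: "finite (carrier R)"
    and locally_principal: "primeideal P R \<Longrightarrow>
      \<exists>p\<in>P. \<exists>u\<in>carrier R - P. \<forall>q\<in>P. \<exists>w\<in>carrier R. u \<otimes> q = p \<otimes> w"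

section \<open>Powers of ideals and local orders\<close>

context cring
begin

definition ideal_pow :: "'a set \<Rightarrow> nat \<Rightarrow> 'a set"
  where "ideal_pow I n = I [^]\<^bsub>ideals_set R\<^esub> n"

lemma ideal_pow_0: "ideal_pow I 0 = carrier R"
proof -
  interpret S: comm_monoid "ideals_set R" by (rule ideals_set_is_comm_monoid)
  show ?thesis using S.nat_pow_0[of I] by (simp add: ideal_pow_def ideals_set_def)
qed

lemma ideal_pow_Suc: "ideal_pow I (Suc n) = ideal_pow I n \<cdot> I"
proof -
  interpret S: comm_monoid "ideals_set R" by (rule ideals_set_is_comm_monoid)
  show ?thesis using S.nat_pow_Suc[of I n] by (simp add: ideal_pow_def ideals_set_def)
qed

lemma ideal_ideal_pow: "ideal I R \<Longrightarrow> ideal (ideal_pow I n) R"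
  by (induction n) (auto simp: ideal_pow_0 ideal_pow_Suc oneideal ideal_prod_is_ideal)

lemma ideal_pow_1: "ideal I R \<Longrightarrow> ideal_pow I (Suc 0) = I"
  using ideal_prod_commute[OF oneideal] ideal_prod_one
  by (simp add: ideal_pow_Suc[of I 0] ideal_pow_0)

lemma ideal_pow_add:
  assumes "ideal I R"
  shows "ideal_pow I (m + n) = ideal_pow I m \<cdot> ideal_pow I n"
  by (induction n)
    (simp_all add: ideal_pow_0 ideal_pow_Suc ideal_prod_one ideal_prod_assoc ideal_ideal_pow assms)

lemma ideal_pow_antimono:
  assumes "ideal I R" and "m \<le> n"
  shows "ideal_pow I n \<subseteq> ideal_pow I m"
proof -
  have "ideal_pow I (Suc k) \<subseteq> ideal_pow I k" for k
    using ideal_prod_inter[OF ideal_ideal_pow[OF assms(1)] assms(1)] by (auto simp: ideal_pow_Suc)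
  then show ?thesis using assms(2) by (rule lift_Suc_antimono_le)
qed

lemma ideal_pow_subset:
  assumes "ideal I R" and "0 < n"
  shows "ideal_pow I n \<subseteq> I"
  using ideal_pow_antimono[of I "Suc 0" n] assms by (simp add: ideal_pow_1)

text \<open>An idempotent equals all its positive powers. A product of positive order below the
  index is thereby excluded from being idempotent.\<close>

lemma idempotent_mem_ideal_pow:
  assumes I: "ideal I R" and e: "e \<in> I" "e \<otimes> e = e"
  shows "e \<in> ideal_pow I n"
proof (induction n)
  case 0
  then show ?case using I e by (simp add: ideal_pow_0 ideal.Icarr)
next
  case (Suc n)
  then have "e \<otimes> e \<in> ideal_pow I n \<cdot> I" using e by (intro ideal_prod.prod)
  then show ?case using e by (simp add: ideal_pow_Suc)
qed

lemma finprod_mem_ideal: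
  assumes I: "ideal I R" and A: "finite A" "f \<in> A \<rightarrow> carrier R" and i: "i \<in> A" "f i \<in> I"
  shows "finprod R f A \<in> I"
proof -
  have "finprod R f A = f i \<otimes> finprod R f (A - {i})"
    using A i finprod_insert[of "A - {i}" i f] by (auto simp: insert_absorb Pi_def)
  moreover have "finprod R f (A - {i}) \<in> carrier R" using A by (intro finprod_closed) auto
  ultimately show ?thesis using I i by (simp add: ideal.I_r_closed)
qed

text \<open>When \<open>P\<close> is prime, \<open>s\<close> becomes a unit in the localization at \<open>P\<close>, so the property says that
  \<open>x\<close> divides \<open>P\<^sup>k\<close> there.\<close>

definition local_order_le :: "'a set \<Rightarrow> nat \<Rightarrow> 'a \<Rightarrow> bool"
  where "local_order_le P k x \<longleftrightarrow> x \<in> carrier R \<and>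
    (\<exists>s\<in>carrier R - P. \<forall>q\<in>ideal_pow P k. \<exists>w\<in>carrier R. s \<otimes> q = x \<otimes> w)"

lemma local_order_le_0:
  assumes "x \<in> carrier R" "x \<notin> P"
  shows "local_order_le P 0 x"
  using assms unfolding local_order_le_def by (auto simp: ideal_pow_0)

text \<open>The multipliers multiply: \<open>s i = x v\<close> and \<open>t j = y w\<close> give
  \<open>s t i j = x y v w\<close>, and \<open>s t\<close> avoids the prime \<open>P\<close>. As one
  multiplier serves all elements, the property passes to sums of such products.\<close>

lemma local_order_le_mult:
  assumes P: "primeideal P R" and "local_order_le P k x" and "local_order_le P l y"
  shows "local_order_le P (k + l) (x \<otimes> y)"
proof -
  interpret P: primeideal P R by fact
  obtain s where s: "s \<in> carrier R - P" "\<And>q. q \<in> ideal_pow P k \<Longrightarrow> \<exists>w\<in>carrier R. s \<otimes> q = x \<otimes> w"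
    and x: "x \<in> carrier R"
    using assms(2) unfolding local_order_le_def by blast
  obtain t where t: "t \<in> carrier R - P" "\<And>q. q \<in> ideal_pow P l \<Longrightarrow> \<exists>w\<in>carrier R. t \<otimes> q = y \<otimes> w"
    and y: "y \<in> carrier R"
    using assms(3) unfolding local_order_le_def by blast
  have st: "s \<otimes> t \<in> carrier R - P" using s t P.I_prime by auto
  \<comment> \<open>Membership in the carrier is carried along for the sum case of the
    induction.\<close>
  have "q \<in> carrier R \<and> (\<exists>w\<in>carrier R. s \<otimes> t \<otimes> q = x \<otimes> y \<otimes> w)"
    if "q \<in> ideal_pow P k \<cdot> ideal_pow P l" for q
    using that
  proof (induction q rule: ideal_prod.induct)
    case (prod i j)
    obtain v w where v: "v \<in> carrier R" "s \<otimes> i = x \<otimes> v" and w: "w \<in> carrier R" "t \<otimes> j = y \<otimes> w"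
      using s(2)[OF prod(1)] t(2)[OF prod(2)] by blast
    have ij: "i \<in> carrier R" "j \<in> carrier R"
      using prod ideal_ideal_pow[OF P.is_ideal] ideal.Icarr by metis+
    have "s \<otimes> t \<otimes> (i \<otimes> j) = (s \<otimes> i) \<otimes> (t \<otimes> j)" using s t ij by (simp add: m_ac)
    also have "\<dots> = x \<otimes> y \<otimes> (v \<otimes> w)" unfolding v(2) w(2) using x y v w by (simp add: m_ac)
    finally show ?case using v w ij by blast
  next
    case (sum a b)
    then obtain v w where v: "v \<in> carrier R" "s \<otimes> t \<otimes> a = x \<otimes> y \<otimes> v"
      and w: "w \<in> carrier R" "s \<otimes> t \<otimes> b = x \<otimes> y \<otimes> w" by blast
    have "s \<otimes> t \<otimes> (a \<oplus> b) = x \<otimes> y \<otimes> (v \<oplus> w)"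
      using st v w x y sum by (simp add: r_distr)
    then show ?case using v w sum by blast
  qed
  then show ?thesis
    unfolding local_order_le_def ideal_pow_add[OF P.is_ideal] using st x y by blast
qed

lemma local_order_le_finprod:
  assumes P: "primeideal P R" and "finite A" and "\<And>i. i \<in> A \<Longrightarrow> local_order_le P (k i) (f i)"
  shows "local_order_le P (sum k A) (finprod R f A)"
  using assms(2,3)
proof (induction A rule: finite_induct)
  case empty
  have "\<one> \<notin> P"
    using P ideal.one_imp_carrier primeideal.axioms(1) primeideal.I_notcarr by blast
  then show ?case by (simp add: local_order_le_0)
next
  case (insert a A)
  then have "f \<in> insert a A \<rightarrow> carrier R" by (auto simp: local_order_le_def)
  then have "finprod R f (insert a A) = f a \<otimes> finprod R f A"
    using insert.hyps by (intro finprod_insert) auto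
  then show ?case using insert local_order_le_mult[OF P] by simp
qed

end

section \<open>Orders below the index of a prime\<close>

context finite_locally_principal_ring
begin

lemma ideal_finite: "ideal I R \<Longrightarrow> finite I"
  using finite_carrier by (meson finite_subset ideal.Icarr subsetI)

lemma finite_Spec: "finite (Spec R)"
proof (rule finite_subset)
  show "Spec R \<subseteq> Pow (carrier R)"
    by (auto simp: Spec_def dest: primeideal.axioms(1) ideal.Icarr)
  show "finite (Pow (carrier R))" using finite_carrier by simp
qed

text \<open>A strictly descending chain of powers would have ever smaller cardinalities.\<close>

lemma ideal_pow_stabilizes:
  assumes I: "ideal I R"
  shows "\<exists>t>0. ideal_pow I t = ideal_pow I (t + 1)"
proof (rule ccontr)
  assume n: "\<not> ?thesis"
  have "card (ideal_pow I (Suc n)) + n \<le> card (ideal_pow I (Suc 0))" for n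
  proof (induction n)
    case (Suc n)
    have "ideal_pow I (Suc (Suc n)) \<subset> ideal_pow I (Suc n)"
      using n ideal_pow_antimono[OF I, of "Suc n" "Suc (Suc n)"] by auto
    then have "card (ideal_pow I (Suc (Suc n))) < card (ideal_pow I (Suc n))"
      using psubset_card_mono[OF ideal_finite[OF ideal_ideal_pow[OF I]]] by blast
    then show ?case using Suc by simp
  qed simp
  from this[of "Suc (card (ideal_pow I (Suc 0)))"] show False by simp
qed

lemma ideal_index_pos: "ideal I R \<Longrightarrow> 0 < ideal_index R I"
  using LeastI_ex[OF ideal_pow_stabilizes] by (simp add: ideal_index_def ideal_pow_def)

lemma ideal_pow_neq_Suc:
  assumes "0 < t" "t < ideal_index R I"
  shows "ideal_pow I t \<noteq> ideal_pow I (Suc t)"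
  using not_less_Least[of t "\<lambda>t. 0 < t \<and> ideal_pow I t = ideal_pow I (t + 1)"] assms
  by (simp add: ideal_index_def ideal_pow_def)

text \<open>A finite domain is a field: two powers of \<open>x\<close> coincide, say
  \<open>x^i = x^(i + Suc k)\<close>, and as \<open>x^i\<close> is outside \<open>P\<close>, the
  prime contains \<open>\<one> - x^k x\<close>. So \<open>x^k\<close> inverts \<open>x\<close>
  modulo \<open>P\<close>.\<close>

lemma inverse_mod_prime:
  assumes P: "primeideal P R" and x: "x \<in> carrier R" "x \<notin> P"
  shows "\<exists>s\<in>carrier R. \<exists>r\<in>P. \<one> = s \<otimes> x \<oplus> r"
proof -
  interpret P: primeideal P R by fact
  have "\<not> inj (\<lambda>n::nat. x [^] n)"
  proof
    assume "inj (\<lambda>n::nat. x [^] n)"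
    then have "infinite (range (\<lambda>n::nat. x [^] n))" by (simp add: range_inj_infinite)
    moreover have "range (\<lambda>n::nat. x [^] n) \<subseteq> carrier R" using x by auto
    ultimately show False using finite_carrier finite_subset by blast
  qed
  then obtain i j :: nat where ij: "i < j" "x [^] i = x [^] j"
    by (metis (no_types, lifting) injI linorder_neqE_nat)
  obtain k where k: "j = i + Suc k" using ij(1) less_imp_Suc_add by auto
  let ?r = "\<one> \<ominus> x [^] k \<otimes> x"
  have pow: "x [^] n \<notin> P" for n :: nat
  proof (induction n)
    case 0
    then show ?case using P.I_notcarr P.one_imp_carrier by auto
  next
    case (Suc n)
    then show ?case using x P.I_prime[of "x [^] n" x] by auto
  qed
  have "x [^] i \<otimes> ?r = x [^] i \<ominus> x [^] j"
    using x unfolding k by (simp add: a_minus_def r_distr r_minus nat_pow_mult[symmetric] m_assoc)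
  then have "x [^] i \<otimes> ?r \<in> P" using ij(2) x by (simp add: r_neg a_minus_def)
  then have "?r \<in> P" using P.I_prime[of "x [^] i" ?r] pow[of i] x by auto
  moreover have "\<one> = x [^] k \<otimes> x \<oplus> ?r"
    using x a_lcomm[of "x [^] k \<otimes> x" \<one> "\<ominus> (x [^] k \<otimes> x)"] by (simp add: a_minus_def r_neg)
  ultimately show ?thesis using x by (meson nat_pow_closed)
qed

text \<open>An element outside \<open>P\<close> is invertible modulo \<open>P\<close>, so
  multiplication by it is injective on \<open>P^n / P^(n+1)\<close>.\<close>

lemma mem_ideal_if_multiple_mem:
  assumes P: "primeideal P R" and x: "x \<in> ideal_pow P n" and s: "s \<in> carrier R" "s \<notin> P"
    and sx: "s \<otimes> x \<in> ideal_pow P (Suc n)"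
  shows "x \<in> ideal_pow P (Suc n)"
proof -
  interpret P: primeideal P R by fact
  interpret Q: ideal "ideal_pow P (Suc n)" R by (rule ideal_ideal_pow[OF P.is_ideal])
  have xc: "x \<in> carrier R" using x ideal_ideal_pow[OF P.is_ideal] ideal.Icarr by metis
  obtain t r where t: "t \<in> carrier R" and r: "r \<in> P" and e: "\<one> = t \<otimes> s \<oplus> r"
    using inverse_mod_prime[OF P s] by blast
  have rc: "r \<in> carrier R" using r P.Icarr by blast
  have "x = x \<otimes> \<one>" using xc by simp
  also have "\<dots> = t \<otimes> (s \<otimes> x) \<oplus> x \<otimes> r"
    unfolding e using t s rc xc by (simp add: m_ac r_distr)
  finally have "x = t \<otimes> (s \<otimes> x) \<oplus> x \<otimes> r" .
  moreover have "t \<otimes> (s \<otimes> x) \<in> ideal_pow P (Suc n)" using sx t Q.I_l_closed by blast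
  moreover have "x \<otimes> r \<in> ideal_pow P (Suc n)"
    unfolding ideal_pow_Suc using x r by (rule ideal_prod.prod)
  ultimately show ?thesis using Q.a_closed by metis
qed

text \<open>Write \<open>u x = p v\<close> with the local generator \<open>p\<close>. If
  \<open>v\<close> were in \<open>P\<close>, then \<open>u x\<close>, and hence \<open>x\<close>,
  would be in \<open>P^2\<close>. So \<open>x\<close> generates \<open>P\<close> locally as well,
  with multiplier \<open>u v\<close>.\<close>

lemma local_order_le_1:
  assumes P: "primeideal P R" and x: "x \<in> P" "x \<notin> ideal_pow P 2"
  shows "local_order_le P 1 x"
proof -
  interpret P: primeideal P R by fact
  have P1: "ideal_pow P 1 = P" by (simp add: ideal_pow_1 P.is_ideal)
  have P2: "ideal_pow P (Suc 1) = P \<cdot> P" using P1 by (simp only: ideal_pow_Suc)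
  have x2: "x \<notin> ideal_pow P (Suc 1)" using x by (simp add: numeral_2_eq_2)
  have xc: "x \<in> carrier R" using x P.Icarr by blast
  obtain p u where p: "p \<in> P" and u: "u \<in> carrier R" "u \<notin> P"
    and pu: "\<And>q. q \<in> P \<Longrightarrow> \<exists>w\<in>carrier R. u \<otimes> q = p \<otimes> w"
    using locally_principal[OF P] by blast
  have pc: "p \<in> carrier R" using p P.Icarr by blast
  obtain v where v: "v \<in> carrier R" "u \<otimes> x = p \<otimes> v" using pu[OF x(1)] by blast
  have "v \<notin> P"
  proof
    assume "v \<in> P"
    then have "u \<otimes> x \<in> ideal_pow P (Suc 1)"
      unfolding P2 v(2) using p by (intro ideal_prod.prod)
    then show False
      using mem_ideal_if_multiple_mem[OF P _ u, of x 1] x(1) x2 P1 by blast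
  qed
  then have uv: "u \<otimes> v \<in> carrier R - P" using u v P.I_prime by auto
  have "\<exists>w\<in>carrier R. u \<otimes> v \<otimes> q = x \<otimes> w" if q: "q \<in> P" for q
  proof -
    obtain w where w: "w \<in> carrier R" "u \<otimes> q = p \<otimes> w" using pu[OF q] by blast
    have qc: "q \<in> carrier R" using q P.Icarr by blast
    have "u \<otimes> v \<otimes> q = v \<otimes> (u \<otimes> q)" using u v qc by (simp add: m_ac)
    also have "\<dots> = (p \<otimes> v) \<otimes> w" unfolding w(2) using pc v w by (simp add: m_ac)
    also have "\<dots> = x \<otimes> (u \<otimes> w)" unfolding v(2)[symmetric] using u w xc by (simp add: m_ac)
    finally show ?thesis using u w by blast
  qed
  then show ?thesis unfolding local_order_le_def P1 using uv xc by blast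
qed

text \<open>If \<open>x\<close> were in \<open>P^(k+1)\<close>, then \<open>s P^k\<close> would be
  contained in \<open>P^(k+1)\<close>, and cancelling \<open>s\<close> would give
  \<open>P^k = P^(k+1)\<close> too early.\<close>

lemma local_order_le_not_mem:
  assumes P: "primeideal P R" and k: "k < ideal_index R P" and x: "local_order_le P k x"
  shows "x \<notin> ideal_pow P (Suc k)"
proof
  interpret P: primeideal P R by fact
  interpret Q: ideal "ideal_pow P (Suc k)" R by (rule ideal_ideal_pow[OF P.is_ideal])
  assume xk: "x \<in> ideal_pow P (Suc k)"
  obtain s where s: "s \<in> carrier R" "s \<notin> P"
    "\<And>q. q \<in> ideal_pow P k \<Longrightarrow> \<exists>w\<in>carrier R. s \<otimes> q = x \<otimes> w"
    using x unfolding local_order_le_def by blast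
  have "ideal_pow P k \<subseteq> ideal_pow P (Suc k)"
  proof
    fix q assume q: "q \<in> ideal_pow P k"
    then have "s \<otimes> q \<in> ideal_pow P (Suc k)"
      using s(3) Q.I_r_closed[OF xk] by metis
    then show "q \<in> ideal_pow P (Suc k)"
      using mem_ideal_if_multiple_mem[OF P q s(1,2)] by blast
  qed
  then have eq: "ideal_pow P k = ideal_pow P (Suc k)"
    using ideal_pow_antimono[OF P.is_ideal, of k "Suc k"] by auto
  \<comment> \<open>The index is a least positive exponent, so \<open>k = 0\<close> is excluded by
    \<open>P\<close> being proper instead.\<close>
  show False
  proof (cases "k = 0")
    case True
    then show False using eq P.I_notcarr by (simp add: ideal_pow_0 ideal_pow_1 P.is_ideal)
  next
    case False
    then show False using eq ideal_pow_neq_Suc[of k P] k by simp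
  qed
qed

text \<open>Every factor has order 1 or 0 at \<open>P\<close> according to its membership in
  \<open>P\<close>, so the orders add up to the number of factors in \<open>P\<close>.\<close>

lemma finprod_not_mem_ideal_pow:
  assumes P: "primeideal P R" and A: "finite A" "f \<in> A \<rightarrow> carrier R"
    and f: "\<And>i. \<lbrakk> i \<in> A; f i \<in> P \<rbrakk> \<Longrightarrow> f i \<notin> ideal_pow P 2"
    and k: "card {i\<in>A. f i \<in> P} < ideal_index R P"
  shows "finprod R f A \<notin> ideal_pow P (Suc (card {i\<in>A. f i \<in> P}))"
proof (rule local_order_le_not_mem[OF P k])
  have "local_order_le P (if f i \<in> P then 1 else 0) (f i)" if "i \<in> A" for i
    using that A f local_order_le_0 local_order_le_1[OF P] by auto
  from local_order_le_finprod[OF P A(1) this]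
  show "local_order_le P (card {i\<in>A. f i \<in> P}) (finprod R f A)"
    using A(1) by (simp add: sum.If_cases Int_def)
qed

lemma finprod_not_idempotent:
  assumes P: "primeideal P R" and A: "finite A" "f \<in> A \<rightarrow> carrier R"
    and f: "\<And>i. \<lbrakk> i \<in> A; f i \<in> P \<rbrakk> \<Longrightarrow> f i \<notin> ideal_pow P 2"
    and i: "i \<in> A" "f i \<in> P"
    and k: "card {i\<in>A. f i \<in> P} < ideal_index R P"
  shows "finprod R f A \<notin> idempotents R"
proof
  have I: "ideal P R" using P primeideal.axioms(1) by blast
  assume "finprod R f A \<in> idempotents R"
  then have "finprod R f A \<in> ideal_pow P (Suc (card {i\<in>A. f i \<in> P}))"
    using finprod_mem_ideal[OF I A i] by (intro idempotent_mem_ideal_pow[OF I]) (auto simp: idempotents_def)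
  then show False using finprod_not_mem_ideal_pow[OF P A f k] by blast
qed

section \<open>Elements with prescribed orders at the primes\<close>

text \<open>Elements outside a prime are invertible modulo it. This rules out
  \<open>Q \<subseteq> P\<close>, and then makes an element of \<open>Q\<close> outside
  \<open>P\<close> invertible modulo \<open>P\<close>.\<close>

lemma primes_comaximal:
  assumes P: "primeideal P R" and Q: "primeideal Q R" and "P \<noteq> Q"
  shows "\<exists>q\<in>Q. \<exists>p\<in>P. q \<oplus> p = \<one>"
proof -
  interpret P: primeideal P R by fact
  interpret Q: primeideal Q R by fact
  have "\<not> Q \<subseteq> P"
  proof
    assume "Q \<subseteq> P"
    then obtain x where x: "x \<in> P" "x \<notin> Q" using \<open>P \<noteq> Q\<close> by blast
    then obtain s r where "s \<in> carrier R" "r \<in> Q" "\<one> = s \<otimes> x \<oplus> r"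
      using inverse_mod_prime[OF Q] P.Icarr by blast
    then have "\<one> \<in> P" using \<open>Q \<subseteq> P\<close> x(1) P.I_l_closed P.a_closed by (metis subsetD)
    then show False using P.I_notcarr P.one_imp_carrier by blast
  qed
  then obtain y where y: "y \<in> Q" "y \<notin> P" by blast
  then obtain s r where "s \<in> carrier R" "r \<in> P" "\<one> = s \<otimes> y \<oplus> r"
    using inverse_mod_prime[OF P] Q.Icarr by blast
  then show ?thesis using y(1) Q.I_l_closed by metis
qed

text \<open>A piece of the Chinese remainder theorem: \<open>f\<close> is 0 modulo every prime in
  \<open>F\<close> and 1 modulo \<open>P^2\<close>.\<close>

lemma comaximal_prime_square_primes:
  assumes P: "primeideal P R" and "finite F" and "\<And>Q. Q \<in> F \<Longrightarrow> primeideal Q R" and "P \<notin> F"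
  shows "\<exists>f\<in>carrier R. \<exists>z\<in>ideal_pow P 2. (\<forall>Q\<in>F. f \<in> Q) \<and> f \<oplus> z = \<one>"
  using assms(2-4)
proof (induction F rule: finite_induct)
  case empty
  interpret P: primeideal P R by fact
  interpret P2: ideal "ideal_pow P 2" R by (rule ideal_ideal_pow[OF P.is_ideal])
  show ?case by (intro bexI[of _ \<one>] bexI[of _ \<zero>]) (simp_all add: P2.zero_closed)
next
  case (insert Q F)
  interpret P: primeideal P R by fact
  interpret P2: ideal "ideal_pow P 2" R by (rule ideal_ideal_pow[OF P.is_ideal])
  interpret Q: primeideal Q R using insert by simp
  obtain f z where f: "f \<in> carrier R" and z: "z \<in> ideal_pow P 2" and fz: "f \<oplus> z = \<one>"
    and fF: "\<And>Q. Q \<in> F \<Longrightarrow> f \<in> Q"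
    using insert by auto
  obtain q p where q: "q \<in> Q" and p: "p \<in> P" and qp: "q \<oplus> p = \<one>"
    using primes_comaximal[of P Q] P Q.primeideal insert.prems by auto
  have c: "q \<in> carrier R" "p \<in> carrier R" "z \<in> carrier R"
    using q p z Q.Icarr P.Icarr P2.Icarr by blast+
  \<comment> \<open>Squaring \<open>q + p = 1\<close> gives \<open>q (q + p + p) + p p = 1\<close>,
    with the first summand in \<open>Q\<close> and the second in \<open>P^2\<close>.\<close>
  let ?f = "f \<otimes> (q \<otimes> (q \<oplus> p \<oplus> p))" and ?z = "f \<otimes> (p \<otimes> p) \<oplus> z"
  have pp: "p \<otimes> p \<in> ideal_pow P 2"
    using ideal_prod.prod[OF p p, of R] P.is_ideal
    by (simp add: numeral_2_eq_2 ideal_pow_Suc[of P "Suc 0"] ideal_pow_1)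
  have "q \<otimes> (q \<oplus> p \<oplus> p) \<oplus> p \<otimes> p = (q \<oplus> p) \<otimes> (q \<oplus> p)"
    using c by (simp add: l_distr r_distr a_ac m_ac)
  then have one: "q \<otimes> (q \<oplus> p \<oplus> p) \<oplus> p \<otimes> p = \<one>" using qp by simp
  have "?f \<oplus> ?z = f \<otimes> (q \<otimes> (q \<oplus> p \<oplus> p) \<oplus> p \<otimes> p) \<oplus> z"
    using c f by (simp add: r_distr[of _ _ f] a_assoc)
  then have "?f \<oplus> ?z = \<one>" using one f fz by simp
  moreover have "?z \<in> ideal_pow P 2" using pp z f P2.I_l_closed P2.a_closed by blast
  moreover have "?f \<in> Q'" if "Q' \<in> insert Q F" for Q'
  proof (cases "Q' = Q")
    case True
    then show ?thesis using q c f Q.I_l_closed Q.I_r_closed by (metis a_closed)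
  next
    case False
    then interpret Q': primeideal Q' R using that insert.prems by simp
    show ?thesis using False that fF c Q'.I_r_closed by auto
  qed
  moreover have "?f \<in> carrier R" using f c by simp
  ultimately show ?case by blast
qed

text \<open>For \<open>y\<close> in \<open>P\<close> but not in \<open>P^2\<close>, the element
  \<open>y f + z\<close> is congruent to \<open>y\<close> modulo \<open>P^2\<close> and to 1 modulo
  every other prime.\<close>

lemma exists_uniformizer:
  assumes P: "primeideal P R" and ind: "1 < ideal_index R P"
  shows "\<exists>x\<in>P. x \<notin> ideal_pow P 2 \<and> (\<forall>Q\<in>Spec R - {P}. x \<notin> Q)"
proof -
  interpret P: primeideal P R by fact
  interpret P2: ideal "ideal_pow P 2" R by (rule ideal_ideal_pow[OF P.is_ideal])
  have "P \<noteq> ideal_pow P 2"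
    using ideal_pow_neq_Suc[of "Suc 0" P] ind
    by (simp add: ideal_pow_1[OF P.is_ideal] numeral_2_eq_2)
  moreover have sub: "ideal_pow P 2 \<subseteq> P" by (simp add: ideal_pow_subset P.is_ideal)
  ultimately obtain y where y: "y \<in> P" "y \<notin> ideal_pow P 2" by blast
  obtain f z where f: "f \<in> carrier R" and z: "z \<in> ideal_pow P 2" and fz: "f \<oplus> z = \<one>"
    and fQ: "\<And>Q. Q \<in> Spec R - {P} \<Longrightarrow> f \<in> Q"
  proof -
    have "\<exists>f\<in>carrier R. \<exists>z\<in>ideal_pow P 2. (\<forall>Q\<in>Spec R - {P}. f \<in> Q) \<and> f \<oplus> z = \<one>"
      by (rule comaximal_prime_square_primes[OF P]) (use finite_Spec in \<open>auto simp: Spec_def\<close>)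
    then show thesis using that by blast
  qed
  note yc = P.Icarr[OF y(1)] and zc = P2.Icarr[OF z]
  let ?x = "y \<otimes> f \<oplus> z"
  have "?x \<in> P" by (rule P.a_closed[OF P.I_r_closed[OF y(1) f] subsetD[OF sub z]])
  moreover have "?x \<notin> ideal_pow P 2"
  proof
    assume "?x \<in> ideal_pow P 2"
    \<comment> \<open>Adding \<open>y z - z\<close> to \<open>?x\<close> gives
      \<open>y (f + z) = y\<close>.\<close>
    moreover have "y \<otimes> z \<oplus> \<ominus> z \<in> ideal_pow P 2"
      by (intro P2.a_closed P2.I_l_closed P2.a_inv_closed z yc)
    ultimately have "?x \<oplus> (y \<otimes> z \<oplus> \<ominus> z) \<in> ideal_pow P 2" by (rule P2.a_closed)
    moreover have "?x \<oplus> (y \<otimes> z \<oplus> \<ominus> z) = y \<otimes> (f \<oplus> z)"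
      using yc zc f by (simp add: r_distr a_assoc a_comm[of "y \<otimes> z"] r_neg2)
    ultimately have "y \<otimes> (f \<oplus> z) \<in> ideal_pow P 2" by (simp only:)
    then show False using y(2) yc fz by simp
  qed
  moreover have "?x \<notin> Q" if Q: "Q \<in> Spec R - {P}" for Q
  proof
    interpret Q: primeideal Q R using Q by (simp add: Spec_def)
    assume "?x \<in> Q"
    \<comment> \<open>Adding \<open>f - y f\<close> to \<open>?x\<close> gives
      \<open>f + z = \<one>\<close>.\<close>
    moreover have "\<ominus> (y \<otimes> f) \<oplus> f \<in> Q"
      by (intro Q.a_closed Q.a_inv_closed Q.I_l_closed fQ[OF Q] yc)
    ultimately have "?x \<oplus> (\<ominus> (y \<otimes> f) \<oplus> f) \<in> Q" by (rule Q.a_closed)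
    moreover have "?x \<oplus> (\<ominus> (y \<otimes> f) \<oplus> f) = f \<oplus> z"
      using yc zc f by (simp add: a_comm[of "y \<otimes> f" z] a_comm[of f z] a_assoc r_neg2)
    ultimately show False using fz Q.I_notcarr Q.one_imp_carrier by simp
  qed
  ultimately show ?thesis by blast
qed

text \<open>The product of uniformizers at the primes in \<open>S\<close> works; its order at any
  prime is 0 or 1.\<close>

lemma exists_element_with_prime_support:
  assumes S: "S \<subseteq> Spec R" and ind: "\<And>P. P \<in> S \<Longrightarrow> 1 < ideal_index R P"
  shows "\<exists>x\<in>carrier R. \<forall>P\<in>Spec R. (x \<in> P \<longleftrightarrow> P \<in> S) \<and> x \<notin> ideal_pow P 2"
proof -
  have fin: "finite S" using S finite_Spec finite_subset by blast
  have "\<forall>P\<in>S. \<exists>x\<in>P. x \<notin> ideal_pow P 2 \<and> (\<forall>Q\<in>Spec R - {P}. x \<notin> Q)"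
    using S ind exists_uniformizer by (auto simp: Spec_def)
  then obtain \<pi> where \<pi>: "\<And>P. P \<in> S \<Longrightarrow> \<pi> P \<in> P" "\<And>P. P \<in> S \<Longrightarrow> \<pi> P \<notin> ideal_pow P 2"
    "\<And>P Q. \<lbrakk> P \<in> S; Q \<in> Spec R; Q \<noteq> P \<rbrakk> \<Longrightarrow> \<pi> P \<notin> Q"
    by (metis Diff_iff singletonD)
  have idl: "ideal P R" if "P \<in> Spec R" for P
    using that primeideal.axioms(1) by (auto simp: Spec_def)
  have \<pi>c: "\<pi> \<in> S \<rightarrow> carrier R" using \<pi>(1) S ideal.Icarr[OF idl] by blast
  have "(finprod R \<pi> S \<in> P \<longleftrightarrow> P \<in> S) \<and> finprod R \<pi> S \<notin> ideal_pow P 2" if P: "P \<in> Spec R" for P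
  proof -
    have prime: "primeideal P R" using P by (simp add: Spec_def)
    \<comment> \<open>Among the uniformizers only the one belonging to \<open>P\<close> lies in
      \<open>P\<close>.\<close>
    have supp: "{Q \<in> S. \<pi> Q \<in> P} = (if P \<in> S then {P} else {})"
      using \<pi>(1,3) P by auto
    have 2: "\<pi> Q \<notin> ideal_pow P 2" if "Q \<in> S" "\<pi> Q \<in> P" for Q
      using that \<pi>(2)[of Q] \<pi>(3)[of Q P] P by auto
    have lt: "card {Q \<in> S. \<pi> Q \<in> P} < ideal_index R P"
      unfolding supp using ind ideal_index_pos[OF idl[OF P]] by auto
    have *: "finprod R \<pi> S \<notin> ideal_pow P (Suc (card {Q \<in> S. \<pi> Q \<in> P}))"
      by (rule finprod_not_mem_ideal_pow[OF prime fin \<pi>c 2 lt])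
    show ?thesis
    proof (cases "P \<in> S")
      case True
      have "card {Q \<in> S. \<pi> Q \<in> P} = 1" unfolding supp using True by simp
      then show ?thesis
        using * True finprod_mem_ideal[OF idl[OF P] fin \<pi>c True \<pi>(1)[OF True]]
        by (simp add: numeral_2_eq_2)
    next
      case False
      have "card {Q \<in> S. \<pi> Q \<in> P} = 0" unfolding supp using False by simp
      then have "finprod R \<pi> S \<notin> P" using * idl[OF P] by (simp add: ideal_pow_1)
      then show ?thesis using False ideal_pow_subset[OF idl[OF P], of 2] by auto
    qed
  qed
  moreover have "finprod R \<pi> S \<in> carrier R" using \<pi>c by (rule finprod_closed)
  ultimately show ?thesis by blast
qed

end


section \<open>Orbits of prime ideals\<close>

text \<open>The constraint for \<open>d = h\<close> bounds the sums and \<open>t = 0\<close> is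
  admissible, so \<open>Max\<close> ranges over a finite nonempty set.\<close>

lemma T_max_attained:
  assumes "0 < m"
  obtains t :: "nat \<Rightarrow> nat" where "T_max m h = (\<Sum>i=1..h. t i)"
    and "\<And>d. d \<in> {1..h} \<Longrightarrow> (\<Sum>i=1..d. i * t i) < d * m"
proof -
  let ?M = "{\<Sum>i=1..h. t i |t :: nat \<Rightarrow> nat. \<forall>d\<in>{1..h}. (\<Sum>i=1..d. i * t i) < d * m}"
  have "?M \<subseteq> {..h * m}"
  proof
    fix s assume "s \<in> ?M"
    then obtain t :: "nat \<Rightarrow> nat" where s: "s = (\<Sum>i=1..h. t i)"
      and t: "\<forall>d\<in>{1..h}. (\<Sum>i=1..d. i * t i) < d * m" by blast
    show "s \<in> {..h * m}"
    proof (cases "h = 0")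
      case True
      then show ?thesis using s by simp
    next
      case False
      have "s \<le> (\<Sum>i=1..h. i * t i)" unfolding s by (rule sum_mono) simp
      also have "\<dots> < h * m" using t False by simp
      finally show ?thesis by simp
    qed
  qed
  then have "finite ?M" using finite_subset by blast
  moreover have "(\<Sum>i=1..h. 0) \<in> ?M" using assms by (intro CollectI exI[of _ "\<lambda>_. 0"]) simp
  ultimately have "T_max m h \<in> ?M" unfolding T_max_def by (intro Max_in) blast+
  then show thesis using that by blast
qed

text \<open>Constraint \<open>d\<close> forces \<open>d * t d < d\<close>. This settles the primes
  with \<open>P = P^2\<close>, which have no element of order 1.\<close>

lemma T_max_1: "T_max 1 h = 0"
proof -
  obtain t :: "nat \<Rightarrow> nat" where T: "T_max 1 h = (\<Sum>i=1..h. t i)"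
    and t: "\<And>d. d \<in> {1..h} \<Longrightarrow> (\<Sum>i=1..d. i * t i) < d * 1"
    using T_max_attained[of 1 h] by auto
  have "t d = 0" if "d \<in> {1..h}" for d
  proof -
    have "d * t d \<le> (\<Sum>i=1..d. i * t i)"
      using that by (intro member_le_sum[of d "{1..d}" "\<lambda>i. i * t i"]) auto
    then show ?thesis using t[OF that] that by (cases "t d") auto
  qed
  then show ?thesis unfolding T by simp
qed

text \<open>The predecessor of a least number violates the defining property, which yields the
  sequence. The predecessor has to be positive, so values at most 1 are served by the empty
  sequence.\<close>

lemma davenport_extremal:
  obtains U where "set_mset U \<subseteq> carrier G" and "davenport \<Psi> G \<le> size U + 1"
    and "\<not> has_weighted_product G \<Psi> U {\<one>\<^bsub>G\<^esub>}"
proof (cases "davenport \<Psi> G \<le> 1")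
  case True
  have "\<not> has_weighted_product G \<Psi> {#} {\<one>\<^bsub>G\<^esub>}" by (simp add: has_weighted_product_def)
  then show thesis using that[of "{#}"] True by simp
next
  case False
  let ?Q = "\<lambda>l. 0 < l \<and>
    (\<forall>T. set_mset T \<subseteq> carrier G \<and> l \<le> size T \<longrightarrow> has_weighted_product G \<Psi> T {\<one>\<^bsub>G\<^esub>})"
  have "davenport \<Psi> G = (LEAST l. ?Q l)" by (simp only: davenport_def)
  moreover have "davenport \<Psi> G - 1 < davenport \<Psi> G" using False by simp
  ultimately have "\<not> ?Q (davenport \<Psi> G - 1)" using not_less_Least[of "davenport \<Psi> G - 1" ?Q] by metis
  then obtain T where "set_mset T \<subseteq> carrier G" "davenport \<Psi> G - 1 \<le> size T"
    "\<not> has_weighted_product G \<Psi> T {\<one>\<^bsub>G\<^esub>}"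
    using False by auto
  then show thesis using that[of T] by simp
qed

lemma (in cring) finprod_units_of:
  assumes "finite A" and "f \<in> A \<rightarrow> Units R"
  shows "finprod (units_of R) f A = finprod R f A"
  using assms
proof (induction A rule: finite_induct)
  case empty
  then show ?case
    using comm_monoid.finprod_empty[OF comm_group.axioms(1)[OF units_comm_group]]
    by (simp add: units_of_one)
next
  case (insert a A)
  have "finprod (units_of R) f (insert a A) = f a \<otimes> finprod (units_of R) f A"
    using comm_monoid.finprod_insert[OF comm_group.axioms(1)[OF units_comm_group], of A a f] insert
    by (auto simp: units_of_carrier units_of_mult)
  also have "\<dots> = finprod R f (insert a A)"
    using insert by (subst finprod_insert) (auto simp: Pi_def)
  finally show ?case .
qed

lemma (in cring) unit_not_mem_primeideal:
  assumes "primeideal P R" and "u \<in> Units R"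
  shows "u \<notin> P"
proof
  interpret P: primeideal P R by fact
  assume "u \<in> P"
  then have "inv u \<otimes> u \<in> P" using assms(2) by (intro P.I_l_closed) auto
  then show False using assms(2) P.one_imp_carrier P.I_notcarr by simp
qed

section \<open>Automorphisms acting on ideals\<close>

locale finite_locally_principal_ring_action = finite_locally_principal_ring +
  fixes \<Psi> :: "('a \<Rightarrow> 'a) set"
  assumes subgroup: "subgroup \<Psi> (RingAutGroup R)"
begin

lemma Psi_ring_auto: "\<psi> \<in> \<Psi> \<Longrightarrow> \<psi> \<in> ring_auto R"
  using subgroup.subset[OF subgroup] by (auto simp: RingAutGroup_def)

lemma Psi_bij_betw: "\<psi> \<in> \<Psi> \<Longrightarrow> bij_betw \<psi> (carrier R) (carrier R)"
  using Psi_ring_auto by (auto simp: ring_auto_def ring_iso_def)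

lemma Psi_hom: "\<psi> \<in> \<Psi> \<Longrightarrow> \<psi> \<in> ring_hom R R"
  using Psi_ring_auto by (auto simp: ring_auto_def ring_iso_def)

lemma Psi_Bij: "\<psi> \<in> \<Psi> \<Longrightarrow> \<psi> \<in> Bij (carrier R)"
  using Psi_ring_auto Psi_bij_betw by (auto simp: ring_auto_def Bij_def)

lemma Psi_closed: "\<psi> \<in> \<Psi> \<Longrightarrow> x \<in> carrier R \<Longrightarrow> \<psi> x \<in> carrier R"
  using Psi_bij_betw by (auto simp: bij_betw_def)

lemma finite_Psi: "finite \<Psi>"
proof (rule finite_subset)
  show "\<Psi> \<subseteq> PiE (carrier R) (\<lambda>_. carrier R)"
    using Psi_ring_auto Psi_closed by (auto simp: ring_auto_def PiE_def)
  show "finite (PiE (carrier R) (\<lambda>_. carrier R))"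
    using finite_carrier by (simp add: finite_PiE)
qed

lemma Psi_compose: "\<psi> \<in> \<Psi> \<Longrightarrow> \<phi> \<in> \<Psi> \<Longrightarrow> compose (carrier R) \<psi> \<phi> \<in> \<Psi>"
  using subgroup.m_closed[OF subgroup, of \<psi> \<phi>] Psi_Bij
  by (simp add: RingAutGroup_def BijGroup_def)

lemma Psi_id: "(\<lambda>x\<in>carrier R. x) \<in> \<Psi>"
  using subgroup.one_closed[OF subgroup] by (simp add: RingAutGroup_def BijGroup_def)

lemma Psi_id_image: "A \<subseteq> carrier R \<Longrightarrow> (\<lambda>x\<in>carrier R. x) ` A = A"
  using image_cong[OF refl, of A "\<lambda>x\<in>carrier R. x" "\<lambda>x. x"] by (simp add: subset_eq)

lemma Psi_inverse:
  assumes \<psi>: "\<psi> \<in> \<Psi>"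
  obtains \<chi> where "\<chi> \<in> \<Psi>" and "\<And>x. x \<in> carrier R \<Longrightarrow> \<chi> (\<psi> x) = x"
    and "\<And>x. x \<in> carrier R \<Longrightarrow> \<psi> (\<chi> x) = x"
proof -
  interpret G: group "RingAutGroup R" by (rule group_RingAutGroup)
  let ?\<chi> = "inv\<^bsub>RingAutGroup R\<^esub> \<psi>"
  have \<chi>: "?\<chi> \<in> \<Psi>" by (rule subgroup.m_inv_closed[OF subgroup \<psi>])
  have \<psi>G: "\<psi> \<in> carrier (RingAutGroup R)" using subgroup.subset[OF subgroup] \<psi> by blast
  have "compose (carrier R) ?\<chi> \<psi> = (\<lambda>x\<in>carrier R. x)"
    using G.l_inv[OF \<psi>G] Psi_Bij \<psi> \<chi> by (simp add: RingAutGroup_def BijGroup_def)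
  moreover have "compose (carrier R) \<psi> ?\<chi> = (\<lambda>x\<in>carrier R. x)"
    using G.r_inv[OF \<psi>G] Psi_Bij \<psi> \<chi> by (simp add: RingAutGroup_def BijGroup_def)
  ultimately have "\<And>x. x \<in> carrier R \<Longrightarrow> ?\<chi> (\<psi> x) = x \<and> \<psi> (?\<chi> x) = x"
    by (metis compose_eq restrict_apply')
  then show thesis using that \<chi> by blast
qed

lemma Spec_ideal: "P \<in> Spec R \<Longrightarrow> ideal P R"
  by (simp add: Spec_def primeideal.axioms(1))

lemma Spec_subset: "P \<in> Spec R \<Longrightarrow> P \<subseteq> carrier R"
  by (rule subsetI) (rule ideal.Icarr[OF Spec_ideal])

lemma compose_image:
  "A \<subseteq> carrier R \<Longrightarrow> compose (carrier R) \<psi> \<phi> ` A = \<psi> ` \<phi> ` A"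
  using image_cong[OF refl, of A "compose (carrier R) \<psi> \<phi>" "\<lambda>x. \<psi> (\<phi> x)"]
  by (simp add: subset_eq compose_eq image_image)

text \<open>Read as a preimage under the inverse, the image of a prime ideal is prime by the
  preimage lemma.\<close>

lemma image_eq_vimage:
  assumes \<psi>: "\<psi> \<in> \<Psi>" and A: "A \<subseteq> carrier R"
  obtains \<chi> where "\<chi> \<in> \<Psi>" and "\<psi> ` A = {x \<in> carrier R. \<chi> x \<in> A}"
proof -
  obtain \<chi> where \<chi>: "\<chi> \<in> \<Psi>" "\<And>x. x \<in> carrier R \<Longrightarrow> \<chi> (\<psi> x) = x"
      "\<And>x. x \<in> carrier R \<Longrightarrow> \<psi> (\<chi> x) = x"
    using Psi_inverse[OF \<psi>] by blast
  have "\<psi> ` A = {x \<in> carrier R. \<chi> x \<in> A}"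
  proof (intro equalityI subsetI)
    fix x assume "x \<in> \<psi> ` A"
    then show "x \<in> {x \<in> carrier R. \<chi> x \<in> A}" using Psi_closed[OF \<psi>] \<chi> A by auto
  next
    fix x assume "x \<in> {x \<in> carrier R. \<chi> x \<in> A}"
    then have "x = \<psi> (\<chi> x)" "\<chi> x \<in> A" using \<chi>(3) by auto
    then show "x \<in> \<psi> ` A" by blast
  qed
  then show thesis using that \<chi>(1) by blast
qed

lemma image_Spec:
  assumes \<psi>: "\<psi> \<in> \<Psi>" and P: "P \<in> Spec R"
  shows "\<psi> ` P \<in> Spec R"
proof -
  obtain \<chi> where \<chi>: "\<chi> \<in> \<Psi>" "\<psi> ` P = {x \<in> carrier R. \<chi> x \<in> P}"
    using image_eq_vimage[OF \<psi> Spec_subset[OF P]] by blast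
  have "ring_hom_ring R R \<chi>"
    by (rule ring_hom_ringI2[OF ring_axioms ring_axioms Psi_hom[OF \<chi>(1)]])
  then show ?thesis
    using ring_hom_ring.primeideal_vimage[OF _ is_cring, of R \<chi> P] P \<chi> by (simp add: Spec_def)
qed

lemma image_ideal_prod:
  assumes \<psi>: "\<psi> \<in> \<Psi>" and I: "ideal I R" and K: "ideal K R"
  shows "\<psi> ` (I \<cdot> K) = (\<psi> ` I) \<cdot> (\<psi> ` K)"
proof -
  note h = Psi_hom[OF \<psi>]
  have c: "I \<subseteq> carrier R" "K \<subseteq> carrier R" "I \<cdot> K \<subseteq> carrier R"
    using ideal.Icarr[OF I] ideal.Icarr[OF K] ideal_prod_in_carrier[OF I K] by (simp_all add: subsetI)
  show ?thesis
  proof (intro equalityI subsetI)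
    fix x assume "x \<in> (\<psi> ` I) \<cdot> (\<psi> ` K)"
    then show "x \<in> \<psi> ` (I \<cdot> K)"
    proof (induction x rule: ideal_prod.induct)
      case (prod i k)
      obtain i' where i': "i' \<in> I" "i = \<psi> i'" using prod(1) by blast
      obtain k' where k': "k' \<in> K" "k = \<psi> k'" using prod(2) by blast
      have "i \<otimes> k = \<psi> (i' \<otimes> k')"
        unfolding i'(2) k'(2) using i'(1) k'(1) c by (intro ring_hom_mult[OF h, symmetric]) blast+
      moreover have "i' \<otimes> k' \<in> I \<cdot> K" using i'(1) k'(1) by (rule ideal_prod.prod)
      ultimately show ?case by simp
    next
      case (sum a b)
      obtain a' where a': "a' \<in> I \<cdot> K" "a = \<psi> a'" using sum.IH(1) by (rule imageE)
      obtain b' where b': "b' \<in> I \<cdot> K" "b = \<psi> b'" using sum.IH(2) by (rule imageE)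
      have "a \<oplus> b = \<psi> (a' \<oplus> b')"
        unfolding a'(2) b'(2) using a'(1) b'(1) c by (intro ring_hom_add[OF h, symmetric]) blast+
      moreover have "a' \<oplus> b' \<in> I \<cdot> K" using a'(1) b'(1) by (rule ideal_prod.sum)
      ultimately show ?case by simp
    qed
  next
    fix x assume "x \<in> \<psi> ` (I \<cdot> K)"
    then obtain y where y: "x = \<psi> y" "y \<in> I \<cdot> K" by (rule imageE)
    show "x \<in> (\<psi> ` I) \<cdot> (\<psi> ` K)"
      unfolding y(1) using y(2)
    proof (induction y rule: ideal_prod.induct)
      case (prod i k)
      then have "\<psi> (i \<otimes> k) = \<psi> i \<otimes> \<psi> k" using c by (intro ring_hom_mult[OF h]) blast+
      then show ?case using prod by (simp add: ideal_prod.prod)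
    next
      case (sum a b)
      then have "\<psi> (a \<oplus> b) = \<psi> a \<oplus> \<psi> b" using c by (intro ring_hom_add[OF h]) blast+
      then show ?case using sum.IH by (simp add: ideal_prod.sum)
    qed
  qed
qed

lemma image_ideal_pow:
  assumes \<psi>: "\<psi> \<in> \<Psi>" and I: "ideal I R"
  shows "\<psi> ` ideal_pow I n = ideal_pow (\<psi> ` I) n"
proof (induction n)
  case 0
  then show ?case using Psi_bij_betw[OF \<psi>] by (simp add: ideal_pow_0 bij_betw_def)
next
  case (Suc n)
  then show ?case by (simp add: ideal_pow_Suc image_ideal_prod[OF \<psi> ideal_ideal_pow[OF I] I])
qed

lemma ideal_index_image:
  assumes \<psi>: "\<psi> \<in> \<Psi>" and I: "ideal I R"
  shows "ideal_index R (\<psi> ` I) = ideal_index R I"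
proof -
  have sub: "ideal_pow I n \<subseteq> carrier R" for n
    using ideal.Icarr[OF ideal_ideal_pow[OF I]] by blast
  have "ideal_pow (\<psi> ` I) t = ideal_pow (\<psi> ` I) (t + 1) \<longleftrightarrow> ideal_pow I t = ideal_pow I (t + 1)" for t
    unfolding image_ideal_pow[OF \<psi> I, symmetric]
    using Psi_bij_betw[OF \<psi>] sub by (intro inj_on_image_eq_iff) (auto simp: bij_betw_def)
  then show ?thesis unfolding ideal_index_def ideal_pow_def by simp
qed

section \<open>Orbits of primes\<close>

definition prime_orbit :: "'a set \<Rightarrow> 'a set set"
  where "prime_orbit P = (\<lambda>\<psi>. \<psi> ` P) ` \<Psi>"

lemma prime_orbit_subset: "P \<in> Spec R \<Longrightarrow> prime_orbit P \<subseteq> Spec R"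
  unfolding prime_orbit_def by (intro image_subsetI image_Spec)

lemma finite_prime_orbit: "finite (prime_orbit P)"
  using finite_Psi by (simp add: prime_orbit_def)

lemma prime_orbit_refl: "P \<in> Spec R \<Longrightarrow> P \<in> prime_orbit P"
  unfolding prime_orbit_def using Psi_id_image[OF Spec_subset] by (intro image_eqI[OF _ Psi_id]) simp

lemma prime_orbit_closed:
  assumes "P \<in> Spec R" "Q \<in> prime_orbit P" "\<psi> \<in> \<Psi>"
  shows "\<psi> ` Q \<in> prime_orbit P"
proof -
  obtain \<phi> where \<phi>: "\<phi> \<in> \<Psi>" "Q = \<phi> ` P" using assms(2) by (auto simp: prime_orbit_def)
  have "\<psi> ` Q = compose (carrier R) \<psi> \<phi> ` P"
    unfolding \<phi>(2) compose_image[OF Spec_subset[OF assms(1)]] ..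
  then show ?thesis unfolding prime_orbit_def using Psi_compose[OF assms(3) \<phi>(1)] by blast
qed

lemma prime_orbit_sym:
  assumes P: "P \<in> Spec R" and Q: "Q \<in> prime_orbit P"
  shows "P \<in> prime_orbit Q"
proof -
  obtain \<psi> where \<psi>: "\<psi> \<in> \<Psi>" "Q = \<psi> ` P" using Q by (auto simp: prime_orbit_def)
  obtain \<chi> where \<chi>: "\<chi> \<in> \<Psi>" "\<And>x. x \<in> carrier R \<Longrightarrow> \<chi> (\<psi> x) = x"
    using Psi_inverse[OF \<psi>(1)] by blast
  have "\<chi> ` Q = P" using \<chi>(2) Spec_subset[OF P] unfolding \<psi>(2) by force
  then show ?thesis using \<chi>(1) by (auto simp: prime_orbit_def)
qed

lemma prime_orbit_eq:
  assumes P: "P \<in> Spec R" and Q: "Q \<in> prime_orbit P"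
  shows "prime_orbit Q = prime_orbit P"
proof
  have Q': "Q \<in> Spec R" using prime_orbit_subset[OF P] Q by blast
  show "prime_orbit Q \<subseteq> prime_orbit P"
    using prime_orbit_closed[OF P Q] by (auto simp: prime_orbit_def[of Q])
  show "prime_orbit P \<subseteq> prime_orbit Q"
    using prime_orbit_closed[OF Q' prime_orbit_sym[OF P Q]] by (auto simp: prime_orbit_def[of P])
qed

lemma ideal_index_orbit:
  "P \<in> Spec R \<Longrightarrow> Q \<in> prime_orbit P \<Longrightarrow> ideal_index R Q = ideal_index R P"
  unfolding prime_orbit_def by (elim imageE) (simp add: ideal_index_image Spec_ideal)

text \<open>Orbit-stabilizer: the automorphisms taking \<open>P\<close> to \<open>\<phi> P\<close>
  form the coset of the stabilizer given by \<open>\<phi>\<close>.\<close>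

lemma card_prime_orbit:
  assumes P: "P \<in> Spec R"
  shows "card (prime_orbit P) = stabilizer_index \<Psi> P"
proof -
  have fiber: "card {\<psi> \<in> \<Psi>. \<psi> ` P = Q} = card (ideal_stabilizer \<Psi> P)" if Q: "Q \<in> prime_orbit P" for Q
  proof -
    obtain \<phi> where \<phi>: "\<phi> \<in> \<Psi>" "Q = \<phi> ` P" using Q by (auto simp: prime_orbit_def)
    obtain \<chi> where \<chi>: "\<chi> \<in> \<Psi>" "\<And>x. x \<in> carrier R \<Longrightarrow> \<chi> (\<phi> x) = x"
      "\<And>x. x \<in> carrier R \<Longrightarrow> \<phi> (\<chi> x) = x"
      using Psi_inverse[OF \<phi>(1)] by blast
    have \<chi>Q: "\<chi> ` Q = P" using \<chi>(2) Spec_subset[OF P] unfolding \<phi>(2) by force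
    \<comment> \<open>Extensional maps that agree on the carrier are equal, so composing with
      \<open>\<phi>\<close> undoes composing with \<open>\<chi>\<close>.\<close>
    have ext: "\<psi> \<in> extensional (carrier R)" if "\<psi> \<in> \<Psi>" for \<psi>
      using Psi_ring_auto[OF that] by (simp add: ring_auto_def)
    have "bij_betw (compose (carrier R) \<chi>) {\<psi> \<in> \<Psi>. \<psi> ` P = Q} (ideal_stabilizer \<Psi> P)"
    proof (rule bij_betwI[where g = "compose (carrier R) \<phi>"])
      show "compose (carrier R) \<chi> \<in> {\<psi> \<in> \<Psi>. \<psi> ` P = Q} \<rightarrow> ideal_stabilizer \<Psi> P"
        by (simp add: Pi_def ideal_stabilizer_def Psi_compose[OF \<chi>(1)]
            compose_image[OF Spec_subset[OF P]] \<chi>Q)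
      show "compose (carrier R) \<phi> \<in> ideal_stabilizer \<Psi> P \<rightarrow> {\<psi> \<in> \<Psi>. \<psi> ` P = Q}"
        by (simp add: Pi_def ideal_stabilizer_def Psi_compose[OF \<phi>(1)]
            compose_image[OF Spec_subset[OF P]] \<phi>(2))
      show "compose (carrier R) \<phi> (compose (carrier R) \<chi> \<psi>) = \<psi>" if "\<psi> \<in> {\<psi> \<in> \<Psi>. \<psi> ` P = Q}" for \<psi>
        using that \<chi>(3) Psi_closed ext by (intro extensionalityI[of _ "carrier R"]) (auto simp: compose_eq)
      show "compose (carrier R) \<chi> (compose (carrier R) \<phi> \<psi>) = \<psi>" if "\<psi> \<in> ideal_stabilizer \<Psi> P" for \<psi>
        using that \<chi>(2) Psi_closed ext
        by (intro extensionalityI[of _ "carrier R"]) (auto simp: compose_eq ideal_stabilizer_def)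
    qed
    then show ?thesis by (rule bij_betw_same_card)
  qed
  have "card \<Psi> = (\<Sum>Q\<in>prime_orbit P. card {\<psi> \<in> \<Psi>. \<psi> ` P = Q})"
    using sum.image_gen[OF finite_Psi, of "\<lambda>_. 1::nat" "\<lambda>\<psi>. \<psi> ` P"]
    by (simp add: prime_orbit_def)
  then have "card \<Psi> = card (prime_orbit P) * card (ideal_stabilizer \<Psi> P)"
    using fiber by simp
  moreover have "0 < card (ideal_stabilizer \<Psi> P)"
  proof -
    have "(\<lambda>x\<in>carrier R. x) \<in> ideal_stabilizer \<Psi> P"
      using Psi_id Psi_id_image[OF Spec_subset[OF P]] by (simp add: ideal_stabilizer_def)
    moreover have "finite (ideal_stabilizer \<Psi> P)" using finite_Psi by (simp add: ideal_stabilizer_def)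
    ultimately show ?thesis unfolding card_gt_0_iff by blast
  qed
  ultimately show ?thesis by (simp add: stabilizer_index_def)
qed

text \<open>For \<open>x\<close> outside all squares \<open>Q^2\<close> this is the total order of
  \<open>x\<close> over the orbit.\<close>

definition orbit_count :: "'a set set \<Rightarrow> 'a \<Rightarrow> nat"
  where "orbit_count \<O> x = card {P \<in> \<O>. x \<in> P}"

text \<open>An automorphism sends orbit primes containing \<open>y\<close> injectively to orbit
  primes containing the image of \<open>y\<close>; its inverse gives the other inequality.\<close>

lemma orbit_count_image:
  assumes P: "P \<in> Spec R" and \<psi>: "\<psi> \<in> \<Psi>" and x: "x \<in> carrier R"
  shows "orbit_count (prime_orbit P) (\<psi> x) = orbit_count (prime_orbit P) x"
proof -
  have le: "orbit_count (prime_orbit P) y \<le> orbit_count (prime_orbit P) (\<phi> y)"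
    if \<phi>: "\<phi> \<in> \<Psi>" and y: "y \<in> carrier R" for \<phi> y
    unfolding orbit_count_def
  proof (rule card_inj_on_le[where f = "image \<phi>"])
    have sub: "Q \<subseteq> carrier R" if "Q \<in> prime_orbit P" for Q
      by (rule Spec_subset[OF subsetD[OF prime_orbit_subset[OF P] that]])
    show "inj_on ((`) \<phi>) {Q \<in> prime_orbit P. y \<in> Q}"
    proof (rule inj_onI)
      fix A B assume "A \<in> {Q \<in> prime_orbit P. y \<in> Q}" "B \<in> {Q \<in> prime_orbit P. y \<in> Q}"
        and "\<phi> ` A = \<phi> ` B"
      then show "A = B"
        using inj_on_image_eq_iff[OF bij_betw_imp_inj_on[OF Psi_bij_betw[OF \<phi>]], of A B] sub by simp
    qed
    show "(`) \<phi> ` {Q \<in> prime_orbit P. y \<in> Q} \<subseteq> {Q \<in> prime_orbit P. \<phi> y \<in> Q}"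
      using prime_orbit_closed[OF P _ \<phi>] by auto
    show "finite {Q \<in> prime_orbit P. \<phi> y \<in> Q}" using finite_prime_orbit by simp
  qed
  obtain \<chi> where "\<chi> \<in> \<Psi>" "\<chi> (\<psi> x) = x" using Psi_inverse[OF \<psi>] x by blast
  then show ?thesis using le[OF \<psi> x] le[of \<chi> "\<psi> x"] Psi_closed[OF \<psi> x] by simp
qed

text \<open>Applying the inverse \<open>\<chi>\<close> would put \<open>x\<close> into the power of
  \<open>\<chi> P\<close>, which is why the assumption ranges over all primes.\<close>

lemma not_mem_ideal_pow_image:
  assumes \<psi>: "\<psi> \<in> \<Psi>" and x: "x \<in> carrier R" and n: "\<And>Q. Q \<in> Spec R \<Longrightarrow> x \<notin> ideal_pow Q n"
    and P: "P \<in> Spec R"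
  shows "\<psi> x \<notin> ideal_pow P n"
proof
  assume a: "\<psi> x \<in> ideal_pow P n"
  obtain \<chi> where \<chi>: "\<chi> \<in> \<Psi>" "\<chi> (\<psi> x) = x" using Psi_inverse[OF \<psi>] x by blast
  have "x \<in> \<chi> ` ideal_pow P n"
    by (rule image_eqI[where x = "\<psi> x"]) (simp_all add: \<chi>(2) a)
  then show False
    using n[OF image_Spec[OF \<chi>(1) P]] image_ideal_pow[OF \<chi>(1) Spec_ideal[OF P]] by simp
qed

end


section \<open>Sequences without weighted idempotent products\<close>

lemma sum_card_swap:
  assumes "finite A" "finite B"
  shows "(\<Sum>a\<in>A. card {b\<in>B. r a b}) = (\<Sum>b\<in>B. card {a\<in>A. r a b})"
proof -
  have "(\<Sum>a\<in>A. card {b\<in>B. r a b}) = (\<Sum>a\<in>A. \<Sum>b\<in>B. of_bool (r a b))"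
    using assms by (simp add: Int_def)
  also have "\<dots> = (\<Sum>b\<in>B. card {a\<in>A. r a b})"
    using assms by (subst sum.swap) (simp add: Int_def)
  finally show ?thesis .
qed

lemma sum_mset_filter_sum:
  fixes g :: "'a \<Rightarrow> nat"
  assumes "finite I"
  shows "(\<Sum>x\<in>#filter_mset P (\<Sum>i\<in>I. B i). g x) = (\<Sum>i\<in>I. \<Sum>x\<in>#filter_mset P (B i). g x)"
  using assms by (induction I rule: finite_induct) auto

lemma sum_mset_mono_subset:
  fixes g :: "'a \<Rightarrow> nat"
  assumes "A \<subseteq># B"
  shows "(\<Sum>x\<in>#A. g x) \<le> (\<Sum>x\<in>#B. g x)"
  using assms by (auto simp: mset_subset_eq_exists_conv)

lemma filter_mset_replicate:
  "filter_mset P (replicate_mset n a) = (if P a then replicate_mset n a else {#})"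
  by (induction n) auto

lemma set_mset_sum_iff:
  fixes B :: "'i \<Rightarrow> 'a multiset"
  assumes "finite I"
  shows "x \<in># (\<Sum>i\<in>I. B i) \<longleftrightarrow> (\<exists>i\<in>I. x \<in># B i)"
  using assms by (induction I rule: finite_induct) auto

lemma size_sum_mset:
  fixes B :: "'i \<Rightarrow> 'a multiset"
  assumes "finite I"
  shows "size (\<Sum>i\<in>I. B i) = (\<Sum>i\<in>I. size (B i))"
  using assms by (induction I rule: finite_induct) auto

section \<open>The sequence at an orbit and its weighted products\<close>

context finite_locally_principal_ring_action
begin

text \<open>The last condition is constraint \<open>d\<close> of T(m; h), read off the sequence: the
  elements in at most \<open>d\<close> orbit primes contribute the terms \<open>i * t i\<close> with
  \<open>i \<le> d\<close>.\<close>

lemma exists_orbit_sequence: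
  assumes P: "P \<in> Spec R"
  defines "\<O> \<equiv> prime_orbit P" and "m \<equiv> ideal_index R P"
  shows "\<exists>B. set_mset B \<subseteq> carrier R \<and> size B = T_max m (card \<O>) \<and>
    (\<forall>x\<in>#B. \<forall>Q\<in>Spec R. x \<notin> ideal_pow Q 2 \<and> (x \<in> Q \<longrightarrow> Q \<in> \<O>)) \<and>
    (\<forall>x\<in>#B. 0 < orbit_count \<O> x) \<and>
    (\<forall>d\<in>{1..card \<O>}. (\<Sum>x\<in>#filter_mset (\<lambda>x. orbit_count \<O> x \<le> d) B. orbit_count \<O> x) < d * m)"
proof -
  have m0: "0 < m" unfolding m_def by (rule ideal_index_pos[OF Spec_ideal[OF P]])
  have \<O>: "\<O> \<subseteq> Spec R" "finite \<O>"
    unfolding \<O>_def by (rule prime_orbit_subset[OF P], rule finite_prime_orbit)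
  show ?thesis
  \<comment> \<open>For \<open>m = 1\<close> there are no elements of order 1, but T(1; h) is 0 and
    the empty sequence suffices.\<close>
  proof (cases "m = 1")
    case True
    have "T_max m (card \<O>) = 0" unfolding True by (rule T_max_1)
    then show ?thesis using m0 by (intro exI[of _ "{#}"]) simp
  next
    case False
    then have ind: "1 < ideal_index R Q" if "Q \<in> \<O>" for Q
      using m0 ideal_index_orbit[OF P, of Q] that by (simp add: \<O>_def m_def)
    let ?h = "card \<O>"
    obtain t :: "nat \<Rightarrow> nat" where T: "T_max m ?h = (\<Sum>i=1..?h. t i)"
      and t: "\<And>d. d \<in> {1..?h} \<Longrightarrow> (\<Sum>i=1..d. i * t i) < d * m"
      using T_max_attained[OF m0] by blast
    have "\<exists>x. x \<in> carrier R \<and> orbit_count \<O> x = i \<and>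
        (\<forall>Q\<in>Spec R. x \<notin> ideal_pow Q 2 \<and> (x \<in> Q \<longrightarrow> Q \<in> \<O>))" if "i \<in> {1..?h}" for i
    proof -
      \<comment> \<open>Any \<open>i\<close> primes of the orbit may serve as the support.\<close>
      have "i \<le> card \<O>" using that by simp
      then obtain S where S: "S \<subseteq> \<O>" "card S = i"
        using obtain_subset_with_card_n by metis
      have S': "S \<subseteq> Spec R" "\<And>Q. Q \<in> S \<Longrightarrow> 1 < ideal_index R Q"
        using S(1) \<O>(1) ind by blast+
      obtain x where x: "x \<in> carrier R" "\<And>Q. Q \<in> Spec R \<Longrightarrow> (x \<in> Q \<longleftrightarrow> Q \<in> S) \<and> x \<notin> ideal_pow Q 2"
        using exists_element_with_prime_support[OF S'] by blast
      have "{Q \<in> \<O>. x \<in> Q} = S" using x(2) S(1) \<O>(1) by blast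
      then have "orbit_count \<O> x = i" using S(2) by (simp add: orbit_count_def)
      then show ?thesis using x S(1) by blast
    qed
    then have "\<forall>i\<in>{1..?h}. \<exists>x. x \<in> carrier R \<and> orbit_count \<O> x = i \<and>
        (\<forall>Q\<in>Spec R. x \<notin> ideal_pow Q 2 \<and> (x \<in> Q \<longrightarrow> Q \<in> \<O>))" by (rule ballI)
    from bchoice[OF this] obtain a where a: "\<And>i. i \<in> {1..?h} \<Longrightarrow> a i \<in> carrier R"
      "\<And>i. i \<in> {1..?h} \<Longrightarrow> orbit_count \<O> (a i) = i"
      "\<And>i Q. \<lbrakk> i \<in> {1..?h}; Q \<in> Spec R \<rbrakk> \<Longrightarrow> a i \<notin> ideal_pow Q 2 \<and> (a i \<in> Q \<longrightarrow> Q \<in> \<O>)"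
      by blast
    define B where "B = (\<Sum>i\<in>{1..?h}. replicate_mset (t i) (a i))"
    have mem: "\<exists>i\<in>{1..?h}. x = a i" if xB: "x \<in># B" for x
    proof -
      obtain i where "i \<in> {1..?h}" "x \<in># replicate_mset (t i) (a i)"
        using xB unfolding B_def set_mset_sum_iff[OF finite_atLeastAtMost] by blast
      then show ?thesis by (meson in_replicate_mset)
    qed
    have "size B = T_max m ?h" unfolding B_def T size_sum_mset[OF finite_atLeastAtMost] by simp
    moreover have "set_mset B \<subseteq> carrier R" using mem a(1) by blast
    moreover have "x \<notin> ideal_pow Q 2 \<and> (x \<in> Q \<longrightarrow> Q \<in> \<O>)" if "x \<in># B" "Q \<in> Spec R" for x Q
      using mem[OF that(1)] a(3)[OF _ that(2)] by blast
    moreover have "0 < orbit_count \<O> x" if "x \<in># B" for x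
      using mem[OF that] a(2) by auto
    moreover have "(\<Sum>x\<in>#filter_mset (\<lambda>x. orbit_count \<O> x \<le> d) B. orbit_count \<O> x) < d * m"
      if d: "d \<in> {1..?h}" for d
    proof -
      have "(\<Sum>x\<in>#filter_mset (\<lambda>x. orbit_count \<O> x \<le> d) B. orbit_count \<O> x)
          = (\<Sum>i\<in>{1..?h}. if i \<le> d then i * t i else 0)"
        unfolding B_def sum_mset_filter_sum[OF finite_atLeastAtMost]
        by (rule sum.cong[OF refl]) (simp add: a(2) filter_mset_replicate)
      also have "\<dots> = (\<Sum>i=1..d. i * t i)"
        using d by (intro sum.mono_neutral_cong_right) auto
      finally show ?thesis using t[OF d] by simp
    qed
    ultimately show ?thesis by (intro exI[of _ B] conjI ballI) simp_all
  qed
qed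

text \<open>Blocks are indexed by orbits, so that all primes of an orbit share one block. Products
  of units are handled by \<open>U\<close>, all others by a prime at which the order is positive but
  below the index.\<close>

lemma no_weighted_idempotent:
  fixes B :: "'a set set \<Rightarrow> 'a multiset"
  assumes U: "set_mset U \<subseteq> Units R" "\<not> has_weighted_product (units_of R) \<Psi> U {\<one>}"
    and B: "\<And>P. P \<in> Spec R \<Longrightarrow> set_mset (B (prime_orbit P)) \<subseteq> carrier R"
    and supp: "\<And>P x Q. \<lbrakk> P \<in> Spec R; x \<in># B (prime_orbit P); Q \<in> Spec R \<rbrakk>
      \<Longrightarrow> x \<notin> ideal_pow Q 2 \<and> (x \<in> Q \<longrightarrow> Q \<in> prime_orbit P)"
    and pos: "\<And>P x. \<lbrakk> P \<in> Spec R; x \<in># B (prime_orbit P) \<rbrakk> \<Longrightarrow> 0 < orbit_count (prime_orbit P) x"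
    and bound: "\<And>P d. \<lbrakk> P \<in> Spec R; d \<in> {1..card (prime_orbit P)} \<rbrakk> \<Longrightarrow>
      (\<Sum>x\<in>#filter_mset (\<lambda>x. orbit_count (prime_orbit P) x \<le> d) (B (prime_orbit P)).
        orbit_count (prime_orbit P) x) < d * ideal_index R P"
  shows "\<not> has_weighted_product R \<Psi> (U + (\<Sum>\<O>\<in>prime_orbit ` Spec R. B \<O>)) (idempotents R)"
proof
  let ?T = "U + (\<Sum>\<O>\<in>prime_orbit ` Spec R. B \<O>)"
  have fin: "finite (prime_orbit ` Spec R)" using finite_Spec by simp
  have mem_T: "x \<in># ?T \<longleftrightarrow> x \<in># U \<or> (\<exists>P\<in>Spec R. x \<in># B (prime_orbit P))" for x
    by (simp add: set_mset_sum_iff[OF fin])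
  have unit_not_mem: "u \<notin> Q" if "u \<in> Units R" "Q \<in> Spec R" for u Q
    using that unit_not_mem_primeideal by (simp add: Spec_def)
  have B_nonunit: "x \<notin> Units R" if P: "P \<in> Spec R" and x: "x \<in># B (prime_orbit P)" for P x
  proof -
    have "{Q \<in> prime_orbit P. x \<in> Q} \<noteq> {}"
      using pos[OF P x] unfolding orbit_count_def by (metis card.empty less_irrefl)
    then show ?thesis using prime_orbit_subset[OF P] unit_not_mem by blast
  qed
  have T_carrier: "x \<in> carrier R" if "x \<in># ?T" for x
    using that B U(1) unfolding mem_T by (meson Units_closed subsetD)
  have T_square: "x \<notin> ideal_pow Q 2" if "x \<in># ?T" "Q \<in> Spec R" for x Q
  proof (cases "x \<in># U")
    case True
    then show ?thesis
      using ideal_pow_subset[OF Spec_ideal[OF that(2)], of 2] unit_not_mem[OF _ that(2)] U(1) by auto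
  next
    case False
    then show ?thesis using that supp unfolding mem_T by blast
  qed
  assume "has_weighted_product R \<Psi> ?T (idempotents R)"
  then obtain as \<psi> where as: "as \<noteq> []" "mset as \<subseteq># ?T" and \<psi>: "\<And>i. i < length as \<Longrightarrow> \<psi> i \<in> \<Psi>"
    and idem: "(\<Otimes>i\<in>{..<length as}. \<psi> i (as ! i)) \<in> idempotents R"
    unfolding has_weighted_product_def by blast
  define A where "A = {..<length as}"
  define f where "f i = \<psi> i (as ! i)" for i
  have A: "finite A" by (simp add: A_def)
  have as_T: "as ! i \<in># ?T" if "i \<in> A" for i
    using that mset_subset_eqD[OF as(2), of "as ! i"] by (simp add: A_def)
  have as_c: "as ! i \<in> carrier R" if "i \<in> A" for i using T_carrier[OF as_T[OF that]] .
  have \<psi>A: "\<psi> i \<in> \<Psi>" if "i \<in> A" for i using \<psi> that by (simp add: A_def)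
  have f: "f \<in> A \<rightarrow> carrier R" using Psi_closed[OF \<psi>A as_c] by (simp add: f_def)
  have idem': "finprod R f A \<in> idempotents R" using idem by (simp add: f_def[abs_def] A_def)
  have f_square: "f i \<notin> ideal_pow Q 2" if "i \<in> A" "Q \<in> Spec R" for i Q
    unfolding f_def using T_square[OF as_T[OF that(1)]]
    by (intro not_mem_ideal_pow_image[OF \<psi>A[OF that(1)] as_c[OF that(1)] _ that(2)])
  show False
  proof (cases "\<forall>i\<in>A. as ! i \<in> Units R")
    case True
    have "set as \<subseteq> Units R" using True by (auto simp: A_def in_set_conv_nth)
    \<comment> \<open>The terms of the blocks lie in some prime and are not units, so a subsequence
      of units comes from \<open>U\<close>.\<close>
    then have "mset as = filter_mset (\<lambda>x. x \<in> Units R) (mset as)"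
      by (intro filter_mset_eq_conv[THEN iffD2, symmetric]) auto
    also have "\<dots> \<subseteq># filter_mset (\<lambda>x. x \<in> Units R) ?T"
      by (rule multiset_filter_mono[OF as(2)])
    also have "\<dots> = U"
    proof -
      have "filter_mset (\<lambda>x. x \<in> Units R) (\<Sum>\<O>\<in>prime_orbit ` Spec R. B \<O>) = {#}"
        using B_nonunit by (auto simp: set_mset_sum_iff[OF fin])
      moreover have "filter_mset (\<lambda>x. x \<in> Units R) U = U"
        using U(1) by (intro filter_mset_eq_conv[THEN iffD2]) auto
      ultimately show ?thesis by simp
    qed
    finally have sub: "mset as \<subseteq># U" .
    have fU: "f i \<in> Units R" if i: "i \<in> A" for i
    proof -
      have u: "as ! i \<in> Units R" using True i by blast
      note h = Psi_hom[OF \<psi>A[OF i]]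
      have c: "f i \<in> carrier R" "\<psi> i (inv (as ! i)) \<in> carrier R"
        unfolding f_def
        using Psi_closed[OF \<psi>A[OF i] Units_closed[OF u]] Psi_closed[OF \<psi>A[OF i] Units_inv_closed[OF u]]
        by simp_all
      have "f i \<otimes> \<psi> i (inv (as ! i)) = \<one>"
        using u ring_hom_mult[OF h Units_closed[OF u] Units_inv_closed[OF u]] ring_hom_one[OF h]
        by (simp add: f_def)
      moreover from this have "\<psi> i (inv (as ! i)) \<otimes> f i = \<one>" using m_comm[OF c] by simp
      ultimately show ?thesis unfolding Units_def using c by blast
    qed
    have eq: "finprod (units_of R) f A = finprod R f A"
      using fU by (intro finprod_units_of[OF A]) auto
    have "finprod (units_of R) f A \<in> carrier (units_of R)"
      using fU by (intro comm_monoid.finprod_closed[OF comm_group.axioms(1)[OF units_comm_group]])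
        (auto simp: units_of_carrier)
    then have u: "finprod R f A \<in> Units R" unfolding eq by (simp add: units_of_carrier)
    \<comment> \<open>An idempotent unit is \<open>\<one>\<close>.\<close>
    have "finprod R f A \<otimes> finprod R f A = finprod R f A \<otimes> \<one>"
      using idem' u by (simp add: idempotents_def)
    then have "finprod R f A = \<one>" using Units_l_cancel[OF u Units_closed[OF u] one_closed] by blast
    then have "finprod (units_of R) (\<lambda>i. \<psi> i (as ! i)) {..<length as} \<in> {\<one>}"
      using eq by (simp add: f_def[abs_def] A_def)
    then have "has_weighted_product (units_of R) \<Psi> U {\<one>}"
      unfolding has_weighted_product_def using as(1) sub \<psi> by blast
    then show False using U(2) by blast
  next
    case False
    then obtain i where i: "i \<in> A" "as ! i \<notin> Units R" by blast
    then obtain P where P: "P \<in> Spec R" "as ! i \<in># B (prime_orbit P)"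
      using as_T[OF i(1)] U(1) unfolding mem_T by blast
    define \<O> where "\<O> = prime_orbit P"
    define N where "N = orbit_count \<O>"
    \<comment> \<open>\<open>N\<close> vanishes on \<open>U\<close> and on the other blocks, so this
      maximum over the whole subsequence is the largest index used from the block of
      \<open>\<O>\<close>.\<close>
    define d where "d = Max (N ` set as)"
    have \<O>: "\<O> \<subseteq> Spec R" "finite \<O>"
      unfolding \<O>_def by (rule prime_orbit_subset[OF P(1)], rule finite_prime_orbit)
    have "d \<in> N ` set as" unfolding d_def using as(1) by (intro Max_in) auto
    then obtain j where j: "j \<in> A" "N (as ! j) = d" by (auto simp: A_def in_set_conv_nth)
    have le_d: "N x \<le> d" if "x \<in> set as" for x unfolding d_def using that by simp
    have "0 < N (as ! i)" unfolding N_def \<O>_def by (rule pos[OF P])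
    moreover have "N (as ! i) \<le> d" using i by (intro le_d) (simp add: A_def)
    moreover have "d \<le> card \<O>"
      unfolding j(2)[symmetric] N_def orbit_count_def using \<O>(2) by (intro card_mono) auto
    ultimately have d: "d \<in> {1..card \<O>}" by simp
    \<comment> \<open>Units lie in no prime, and distinct orbits are disjoint.\<close>
    have N_other: "N x = 0" if "x \<in># U \<or> (\<exists>Q\<in>Spec R. prime_orbit Q \<noteq> \<O> \<and> x \<in># B (prime_orbit Q))" for x
    proof -
      have "x \<notin> Q" if Q: "Q \<in> \<O>" for Q
        using \<open>x \<in># U \<or> _\<close>
      proof
        assume "x \<in># U"
        then show ?thesis using U(1) unit_not_mem Q \<O>(1) by blast
      next
        assume "\<exists>Q\<in>Spec R. prime_orbit Q \<noteq> \<O> \<and> x \<in># B (prime_orbit Q)"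
        then obtain Q' where Q': "Q' \<in> Spec R" "prime_orbit Q' \<noteq> \<O>" "x \<in># B (prime_orbit Q')" by blast
        show ?thesis
        proof
          assume "x \<in> Q"
          then have "Q \<in> prime_orbit Q'" using supp[OF Q'(1,3)] Q \<O>(1) by blast
          then have "prime_orbit Q = prime_orbit Q'" by (rule prime_orbit_eq[OF Q'(1)])
          moreover have "prime_orbit Q = \<O>"
            using Q unfolding \<O>_def by (rule prime_orbit_eq[OF P(1)])
          ultimately show False using Q'(2) by simp
        qed
      qed
      then have "{Q \<in> \<O>. x \<in> Q} = {}" by blast
      then show ?thesis unfolding N_def orbit_count_def by (simp only: card.empty)
    qed
    \<comment> \<open>No chosen term has index above \<open>d\<close>, so the subsequence lies in
      the part of \<open>?T\<close> with index at most \<open>d\<close>, where only the block of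
      \<open>\<O>\<close> contributes.\<close>
    have sum_N: "(\<Sum>i\<in>A. N (as ! i)) < d * ideal_index R P"
    proof -
      have "(\<Sum>i\<in>A. N (as ! i)) = sum_list (map N as)"
        by (simp add: A_def sum_list_sum_nth atLeast0LessThan)
      also have "\<dots> = (\<Sum>x\<in>#mset as. N x)"
        by (simp only: mset_map[symmetric] sum_mset_sum_list)
      also have "mset as = filter_mset (\<lambda>x. N x \<le> d) (mset as)"
        using le_d by (intro filter_mset_eq_conv[THEN iffD2, symmetric]) auto
      also have "(\<Sum>x\<in>#filter_mset (\<lambda>x. N x \<le> d) (mset as). N x) \<le> (\<Sum>x\<in>#filter_mset (\<lambda>x. N x \<le> d) ?T. N x)"
        by (intro sum_mset_mono_subset multiset_filter_mono as(2))
      also have "\<dots> = (\<Sum>x\<in>#filter_mset (\<lambda>x. N x \<le> d) U. N x)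
          + (\<Sum>\<O>'\<in>prime_orbit ` Spec R. \<Sum>x\<in>#filter_mset (\<lambda>x. N x \<le> d) (B \<O>'). N x)"
        by (simp add: sum_mset_filter_sum[OF fin])
      also have "(\<Sum>x\<in>#filter_mset (\<lambda>x. N x \<le> d) U. N x) = 0"
        using N_other by simp
      also have "(\<Sum>\<O>'\<in>prime_orbit ` Spec R. \<Sum>x\<in>#filter_mset (\<lambda>x. N x \<le> d) (B \<O>'). N x)
          = (\<Sum>\<O>'\<in>{\<O>}. \<Sum>x\<in>#filter_mset (\<lambda>x. N x \<le> d) (B \<O>'). N x)"
      proof (rule sum.mono_neutral_right[OF fin], use P(1) in \<open>simp add: \<O>_def\<close>, rule ballI)
        fix \<O>' assume "\<O>' \<in> prime_orbit ` Spec R - {\<O>}"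
        then have "N x = 0" if "x \<in># B \<O>'" for x using that by (intro N_other) blast
        then show "(\<Sum>x\<in>#filter_mset (\<lambda>x. N x \<le> d) (B \<O>'). N x) = 0" by simp
      qed
      finally show ?thesis using bound[OF P(1), of d] d by (simp add: N_def \<O>_def)
    qed
    \<comment> \<open>\<open>k Q\<close> adds the orders of the factors at \<open>Q\<close>, each 0
      or 1. Double counting and the invariance of \<open>N\<close> under \<open>\<Psi>\<close> give
      its sum over the orbit.\<close>
    define k where "k Q = card {i \<in> A. f i \<in> Q}" for Q
    have sum_k: "(\<Sum>Q\<in>\<O>. k Q) = (\<Sum>i\<in>A. N (as ! i))"
    proof -
      have "(\<Sum>Q\<in>\<O>. k Q) = (\<Sum>i\<in>A. N (f i))"
        unfolding k_def N_def orbit_count_def by (rule sum_card_swap[OF \<O>(2) A])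
      also have "\<dots> = (\<Sum>i\<in>A. N (as ! i))"
        unfolding N_def \<O>_def f_def
        by (intro sum.cong refl orbit_count_image[OF P(1)] \<psi>A as_c)
      finally show ?thesis .
    qed
    define S where "S = {Q \<in> \<O>. f j \<in> Q}"
    have "card S = d"
      using orbit_count_image[OF P(1) \<psi>A[OF j(1)] as_c[OF j(1)]] j(2)
      by (simp add: S_def N_def orbit_count_def \<O>_def f_def)
    \<comment> \<open>Averaging over the \<open>d\<close> primes in \<open>S\<close>; each contains
      \<open>f j\<close>, so the order found is also positive.\<close>
    have "\<exists>Q\<in>S. k Q < ideal_index R P"
    proof (rule ccontr)
      assume "\<not> ?thesis"
      then have "(\<Sum>Q\<in>S. ideal_index R P) \<le> (\<Sum>Q\<in>S. k Q)" by (intro sum_mono) (simp add: not_less)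
      also have "\<dots> \<le> (\<Sum>Q\<in>\<O>. k Q)" using \<O>(2) by (intro sum_mono2) (auto simp: S_def)
      finally show False using sum_k sum_N \<open>card S = d\<close> by simp
    qed
    then obtain Q where Q: "Q \<in> \<O>" "f j \<in> Q" "k Q < ideal_index R P" by (auto simp: S_def)
    have Qs: "Q \<in> Spec R" using Q(1) \<O>(1) by blast
    have "k Q < ideal_index R Q"
      using Q ideal_index_orbit[OF P(1), of Q] by (simp add: \<O>_def)
    then have "finprod R f A \<notin> idempotents R"
      using finprod_not_idempotent[of Q A f j] Qs A f f_square Q(2) j(1)
      by (simp add: k_def Spec_def)
    then show False using idem' by blast
  qed
qed

section \<open>Assembling the bound\<close>

text \<open>An orbit of size \<open>h\<close> contributes \<open>h\<close> equal summands
  \<open>T(m; h) / h\<close>, which is the size of its block.\<close>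

lemma sum_Spec_eq_sum_orbits:
  assumes B: "\<And>P. P \<in> Spec R \<Longrightarrow> size (B (prime_orbit P)) = T_max (ideal_index R P) (card (prime_orbit P))"
  shows "(\<Sum>P\<in>Spec R. real (T_max (ideal_index R P) (stabilizer_index \<Psi> P)) / real (stabilizer_index \<Psi> P))
    = real (\<Sum>\<O>\<in>prime_orbit ` Spec R. size (B \<O>))"
proof -
  let ?g = "\<lambda>P. real (T_max (ideal_index R P) (stabilizer_index \<Psi> P)) / real (stabilizer_index \<Psi> P)"
  have "(\<Sum>P\<in>Spec R. ?g P)
      = (\<Sum>\<O>\<in>prime_orbit ` Spec R. \<Sum>P\<in>{P \<in> Spec R. prime_orbit P = \<O>}. ?g P)"
    by (rule sum.image_gen[OF finite_Spec])
  also have "\<dots> = (\<Sum>\<O>\<in>prime_orbit ` Spec R. real (size (B \<O>)))"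
  proof (intro sum.cong refl)
    fix \<O> assume "\<O> \<in> prime_orbit ` Spec R"
    then obtain P where P: "P \<in> Spec R" "\<O> = prime_orbit P" by blast
    have fiber: "{Q \<in> Spec R. prime_orbit Q = \<O>} = \<O>"
      using prime_orbit_eq[OF P(1)] prime_orbit_refl prime_orbit_subset[OF P(1)] unfolding P(2) by blast
    have "?g Q = real (size (B \<O>)) / real (card \<O>)" if "Q \<in> {Q \<in> Spec R. prime_orbit Q = \<O>}" for Q
      using that B[of Q] card_prime_orbit[of Q] by simp
    then have "(\<Sum>Q\<in>{Q \<in> Spec R. prime_orbit Q = \<O>}. ?g Q)
        = real (card \<O>) * (real (size (B \<O>)) / real (card \<O>))"
      by (simp add: fiber)
    moreover have "card \<O> \<noteq> 0"
      using prime_orbit_refl[OF P(1)] finite_prime_orbit[of P] unfolding P(2) by auto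
    ultimately show "(\<Sum>Q\<in>{Q \<in> Spec R. prime_orbit Q = \<O>}. ?g Q) = real (size (B \<O>))" by simp
  qed
  finally show ?thesis by simp
qed

theorem erdos_burgess_lower_bound:
  "ereal (real (davenport \<Psi> (units_of R)) +
      (\<Sum>P\<in>Spec R. real (T_max (ideal_index R P) (stabilizer_index \<Psi> P)) /
                  real (stabilizer_index \<Psi> P)))
    \<le> ereal_of_enat (erdos_burgess \<Psi> R)"
proof -
  obtain U where U: "set_mset U \<subseteq> carrier (units_of R)" "davenport \<Psi> (units_of R) \<le> size U + 1"
    "\<not> has_weighted_product (units_of R) \<Psi> U {\<one>\<^bsub>units_of R\<^esub>}"
    using davenport_extremal by blast
  define good where "good \<O> B m \<longleftrightarrow> set_mset B \<subseteq> carrier R \<and> size B = T_max m (card \<O>) \<and>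
    (\<forall>x\<in>#B. \<forall>Q\<in>Spec R. x \<notin> ideal_pow Q 2 \<and> (x \<in> Q \<longrightarrow> Q \<in> \<O>)) \<and>
    (\<forall>x\<in>#B. 0 < orbit_count \<O> x) \<and>
    (\<forall>d\<in>{1..card \<O>}.
      (\<Sum>x\<in>#filter_mset (\<lambda>x. orbit_count \<O> x \<le> d) B. orbit_count \<O> x) < d * m)"
    for \<O> B m
  \<comment> \<open>One block has to serve every representative \<open>P\<close> of the orbit; it
    does, since the index is constant on the orbit.\<close>
  have "\<exists>B. \<forall>P\<in>Spec R. \<O> = prime_orbit P \<longrightarrow> good \<O> B (ideal_index R P)"
    if \<O>: "\<O> \<in> prime_orbit ` Spec R" for \<O>
  proof -
    obtain P where P: "P \<in> Spec R" "\<O> = prime_orbit P" using \<O> by blast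
    obtain B where B: "good \<O> B (ideal_index R P)"
      using exists_orbit_sequence[OF P(1)] unfolding good_def P(2) by blast
    have "ideal_index R P = ideal_index R Q" if Q: "Q \<in> Spec R" "\<O> = prime_orbit Q" for Q
      using ideal_index_orbit[OF Q(1), of P] prime_orbit_refl[OF P(1)] P(2) Q(2) by simp
    then show ?thesis using B by metis
  qed
  then have "\<forall>\<O>\<in>prime_orbit ` Spec R. \<exists>B. \<forall>P\<in>Spec R.
      \<O> = prime_orbit P \<longrightarrow> good \<O> B (ideal_index R P)"
    by (rule ballI)
  from bchoice[OF this] obtain B where "\<forall>\<O>\<in>prime_orbit ` Spec R. \<forall>P\<in>Spec R.
      \<O> = prime_orbit P \<longrightarrow> good \<O> (B \<O>) (ideal_index R P)"
    by (elim exE)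
  then have good: "good (prime_orbit P) (B (prime_orbit P)) (ideal_index R P)" if "P \<in> Spec R" for P
    using that by simp
  note B = good[unfolded good_def, THEN conjunct1]
    and size_B = good[unfolded good_def, THEN conjunct2, THEN conjunct1]
    and supp = good[unfolded good_def, THEN conjunct2, THEN conjunct2, THEN conjunct1, rule_format]
    and pos = good[unfolded good_def, THEN conjunct2, THEN conjunct2, THEN conjunct2, THEN conjunct1,
      rule_format]
    and bound = good[unfolded good_def, THEN conjunct2, THEN conjunct2, THEN conjunct2, THEN conjunct2,
      rule_format]
  let ?T = "U + (\<Sum>\<O>\<in>prime_orbit ` Spec R. B \<O>)"
  have fin: "finite (prime_orbit ` Spec R)" using finite_Spec by simp
  have UU: "set_mset U \<subseteq> Units R" using U(1) by (simp add: units_of_carrier)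
  have no: "\<not> has_weighted_product R \<Psi> ?T (idempotents R)"
    using U(3) unfolding units_of_one
    by (rule no_weighted_idempotent[OF UU _ B supp pos bound])
  have carr: "set_mset ?T \<subseteq> carrier R"
  proof
    fix x assume "x \<in># ?T"
    then have "x \<in># U \<or> (\<exists>P\<in>Spec R. x \<in># B (prime_orbit P))"
      by (simp add: set_mset_sum_iff[OF fin])
    then show "x \<in> carrier R" using UU B by blast
  qed
  \<comment> \<open>An admissible length must exceed \<open>size ?T\<close>; this extra 1 matches
    the one in \<open>size U + 1\<close>.\<close>
  have "enat (Suc (size ?T)) \<le> erdos_burgess \<Psi> R"
    unfolding erdos_burgess_def
  proof (rule Inf_greatest)
    fix y assume "y \<in> {enat l |l. \<forall>T. set_mset T \<subseteq> carrier R \<and> l \<le> size T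
      \<longrightarrow> has_weighted_product R \<Psi> T (idempotents R)}"
    then obtain l where l: "y = enat l" "\<forall>T. set_mset T \<subseteq> carrier R \<and> l \<le> size T
      \<longrightarrow> has_weighted_product R \<Psi> T (idempotents R)" by blast
    then have "\<not> l \<le> size ?T" using no carr by blast
    then show "enat (Suc (size ?T)) \<le> y" using l(1) by simp
  qed
  then have "ereal_of_enat (enat (Suc (size ?T))) \<le> ereal_of_enat (erdos_burgess \<Psi> R)"
    by (simp only: ereal_of_enat_le_iff)
  moreover have "real (davenport \<Psi> (units_of R)) +
      (\<Sum>P\<in>Spec R. real (T_max (ideal_index R P) (stabilizer_index \<Psi> P)) /
                  real (stabilizer_index \<Psi> P)) \<le> real (Suc (size ?T))"
  proof -
    have "(\<Sum>P\<in>Spec R. real (T_max (ideal_index R P) (stabilizer_index \<Psi> P)) /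
        real (stabilizer_index \<Psi> P)) = real (\<Sum>\<O>\<in>prime_orbit ` Spec R. size (B \<O>))"
      by (rule sum_Spec_eq_sum_orbits) (rule size_B)
    moreover have "size ?T = size U + (\<Sum>\<O>\<in>prime_orbit ` Spec R. size (B \<O>))"
      by (simp add: size_sum_mset[OF fin])
    ultimately show ?thesis using U(2) by simp
  qed
  ultimately show ?thesis by (simp add: order_trans[rotated])
qed

end

theorem theorem2:
  fixes D :: "('a, 'b) ring_scheme" and J :: "'a set"
    and R :: "'a set ring" and \<Psi> :: "('a set \<Rightarrow> 'a set) set"
  assumes "dedekind_domain D" and "ideal J D" and "R = D Quot J" and "finite (carrier R)"
    and "subgroup \<Psi> (RingAutGroup R)"
  shows "ereal_of_enat (erdos_burgess \<Psi> R) \<ge>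
    ereal (real (davenport \<Psi> (units_of R)) +
      (\<Sum>P\<in>Spec R. real (T_max (ideal_index R P) (stabilizer_index \<Psi> P)) /
                  real (stabilizer_index \<Psi> P)))"
proof -
  interpret D: dedekind_domain D by fact
  have "cring R" unfolding assms(3) by (rule ideal.quotient_is_cring[OF assms(2) D.is_cring])
  then have "finite_locally_principal_ring R"
    using prime_ideal_quotient_locally_principal[OF assms(1,2)] assms(4)
    unfolding finite_locally_principal_ring_def finite_locally_principal_ring_axioms_def assms(3)
    by blast
  then have "finite_locally_principal_ring_action R \<Psi>"
    using assms(5)
    by (simp add: finite_locally_principal_ring_action_def finite_locally_principal_ring_action_axioms_def)
  then show ?thesis
    by (rule finite_locally_principal_ring_action.erdos_burgess_lower_bound)
qed

end
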